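(* Let $\Omega\subset\mathbb{C}^n$ be a bounded pseudoconvex domain with smooth boundary, with signed distance function $\delta$ and normalized complex gradient $N=N_\delta$, and for small $\epsilon>0$ let $\Omega_{-\epsilon}:=\{x\in\Omega:\delta(x)\le-\epsilon\}$ (and $\partial\Omega_{-0}:=\partial\Omega$). Let $L$ be a nonvanishing smooth vector field of type $(1,0)$ defined locally near the points considered and satisfying $L\delta=0$ in a neighborhood of $\partial\Omega$. (1) At every point $p\in\partial\Omega$ with $\operatorname{Hess}_\delta(L,L)|_p=0$, the rate of change is nonpositive: $$(N+\overline N)\langle\nabla_LN,L\rangle\big|_p\le0 .$$ (2) Let $p\in\partial\Omega$, let $\epsilon>0$ be small, and for $0<s\le\epsilon$ let $x_s\in\partial\Omega_{-s}$ be the point with $|x_s-p|=\operatorname{dist}(x_s,\partial\Omega)$; put $x=x_\epsilon$. If $\operatorname{Hess}_\delta(L,L)|_{x_s}=0$ for all $s\in(0,\epsilon]$, then for every $\epsilon'\in[0,\epsilon]$, letting $p'=[x,p]\cap\partial\Omega_{-\epsilon'}$, where $[x,p]$ is the line segment connecting $x$ and $p$, one has $$\langle\nabla_LN,N\rangle\big|_{p'}=0 .$$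
   Context: The signed distance function is $\delta(x)=\operatorname{dist}(x,\partial\Omega)$ for $x\in\Omega^c$ and $\delta(x)=-\operatorname{dist}(x,\partial\Omega)$ for $x\in\Omega$; it is smooth near $\partial\Omega$, and "small $\epsilon$" means that everything takes place in an interior tubular neighborhood of $\partial\Omega$ in which $\delta$ is smooth, nearest boundary points are unique, $\partial\Omega_{-\epsilon}=\{\delta=-\epsilon\}$, and $L$ is defined with $L\delta=0$. $\Omega$ is pseudoconvex if $\operatorname{Hess}_\delta(L_p,L_p)\ge 0$ for all $p\in\partial\Omega$ and all $L_p\in T^{1,0}_p(\partial\Omega)$ (Levi pseudoconvexity), equivalently if $-\log(-\delta)$ is plurisubharmonic in $\Omega$. $\langle\cdot,\cdot\rangle$ is the standard Euclidean inner product of $\mathbb{C}^n=\mathbb{R}^{2n}$ extended to complexified tangent vectors as a Hermitian form (linear in the first slot, conjugate-linear in the second), so that $\langle\partial/\partial z^i,\partial/\partial z^j\rangle=\tfrac12\delta_{ij}$ and $T^{(1,0)}\perp T^{(0,1)}$; $|\cdot|$ is the associated norm. $\nabla_XY$ is the flat (Euclidean) covariant derivative, extended complex-bilinearly to complex vector fields, i.e. componentwise differentiation of $Y$ along $X$; $\nabla f$ is the real gradient of a function $f$. For $X=\sum_i X^i\partial/\partial z^i$ of type $(1,0)$, $\operatorname{Hess}_f(X,X)=X\overline{X}f-(\nabla_X\overline{X})f=\langle\nabla_X\nabla f,X\rangle=\sum_{i,j}\frac{\partial^2 f}{\partial z^i\partial\bar z^j}X^i\overline{X^j}$ is the complex Hessian.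 For a real function $\rho$, $D\rho=\sum_i\frac{\partial\rho}{\partial\bar z^i}\frac{\partial}{\partial z^i}$ is the complex gradient, $N_\rho=|D\rho|^{-1}D\rho$, and $N=N_\delta$. In particular $|D\delta|^2=\tfrac18$, $|N|=1$, $N+\overline N=\sqrt2\,\nabla\delta$ and $N\delta=\tfrac1{\sqrt2}$ near $\partial\Omega$. *)

theory Defs
  imports "HOL-Analysis.Analysis"
begin

text \<open>
  The order on \<^typ>\<open>complex\<close> is the one of \<^theory>\<open>HOL-Library.Complex_Order\<close>:
  \<^prop>\<open>z \<le> (0 :: complex)\<close> says that \<open>z\<close> is real and nonpositive.
\<close>

subsection \<open>Smooth maps\<close>

text \<open>
  Only used for open \<open>S\<close>. Quantifying over all directions \<open>v\<close> amounts to quantifying over a basis,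
  so on a Euclidean space this is continuity of all iterated partial derivatives up to order \<open>k\<close>.
\<close>

primrec Ck_on ::
  "nat \<Rightarrow> 'a set \<Rightarrow> ('a::real_normed_vector \<Rightarrow> 'b::real_normed_vector) \<Rightarrow> bool" where
  "Ck_on 0 S f \<longleftrightarrow> continuous_on S f"
| "Ck_on (Suc k) S f \<longleftrightarrow>
     (\<forall>x\<in>S. f differentiable (at x)) \<and> (\<forall>v. Ck_on k S (\<lambda>x. frechet_derivative f (at x) v))"

definition smooth_on ::
  "'a set \<Rightarrow> ('a::real_normed_vector \<Rightarrow> 'b::real_normed_vector) \<Rightarrow> bool" where
  "smooth_on S f \<longleftrightarrow> (\<forall>k. Ck_on k S f)"

subsection \<open>Complexified tangent vectors of $\mathbb{C}^n$\<close>

text \<open>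
  The pair \<open>(a, b)\<close> stands for
  $\sum_i a_i\,\partial/\partial z^i + \sum_i b_i\,\partial/\partial\bar z^i$.
  A complex vector field is a function into this type.
\<close>

type_synonym 'n ctangent = "(complex ^ 'n) \<times> (complex ^ 'n)"

definition dz :: "'n::finite \<Rightarrow> (complex ^ 'n \<Rightarrow> complex) \<Rightarrow> complex ^ 'n \<Rightarrow> complex" where
  "dz i f p =
     (frechet_derivative f (at p) (axis i 1) - \<i> * frechet_derivative f (at p) (axis i \<i>)) / 2"

definition dzbar :: "'n::finite \<Rightarrow> (complex ^ 'n \<Rightarrow> complex) \<Rightarrow> complex ^ 'n \<Rightarrow> complex" where
  "dzbar i f p =
     (frechet_derivative f (at p) (axis i 1) + \<i> * frechet_derivative f (at p) (axis i \<i>)) / 2"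

definition deriv_along ::
  "'n::finite ctangent \<Rightarrow> (complex ^ 'n \<Rightarrow> complex) \<Rightarrow> complex ^ 'n \<Rightarrow> complex" where
  "deriv_along v f p = (\<Sum>i\<in>UNIV. fst v $ i * dz i f p + snd v $ i * dzbar i f p)"

definition type10 :: "'n::finite ctangent \<Rightarrow> bool" where
  "type10 v \<longleftrightarrow> snd v = 0"

definition conj_tangent :: "'n::finite ctangent \<Rightarrow> 'n ctangent" where
  "conj_tangent v = (\<chi> i. cnj (snd v $ i), \<chi> i. cnj (fst v $ i))"

text \<open>
  The Hermitian extension of the Euclidean inner product; the factor $\frac12$ is
  $\langle\partial/\partial z^i,\partial/\partial z^i\rangle
   = \langle\partial/\partial\bar z^i,\partial/\partial\bar z^i\rangle$.
\<close>

definition herm :: "'n::finite ctangent \<Rightarrow> 'n ctangent \<Rightarrow> complex" where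
  "herm u v = (\<Sum>i\<in>UNIV. fst u $ i * cnj (fst v $ i) + snd u $ i * cnj (snd v $ i)) / 2"

definition herm_norm :: "'n::finite ctangent \<Rightarrow> real" where
  "herm_norm u = sqrt (Re (herm u u))"

definition nabla ::
  "(complex ^ 'n \<Rightarrow> 'n::finite ctangent) \<Rightarrow> (complex ^ 'n \<Rightarrow> 'n ctangent) \<Rightarrow>
   complex ^ 'n \<Rightarrow> 'n ctangent" where
  "nabla X Y p =
     (\<chi> i. deriv_along (X p) (\<lambda>q. fst (Y q) $ i) p,
      \<chi> i. deriv_along (X p) (\<lambda>q. snd (Y q) $ i) p)"

subsection \<open>Complex gradient and complex Hessian of a real function\<close>

definition cgrad :: "(complex ^ 'n \<Rightarrow> real) \<Rightarrow> complex ^ 'n \<Rightarrow> 'n::finite ctangent" where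
  "cgrad \<rho> p = (\<chi> i. dzbar i (\<lambda>q. of_real (\<rho> q)) p, 0)"

definition normalized_cgrad :: "(complex ^ 'n \<Rightarrow> real) \<Rightarrow> complex ^ 'n \<Rightarrow> 'n::finite ctangent" where
  "normalized_cgrad \<rho> p = inverse (herm_norm (cgrad \<rho> p)) *\<^sub>R cgrad \<rho> p"

text \<open>To be applied to vectors \<open>v\<close> of type \<open>(1,0)\<close> only.\<close>

definition complex_hess ::
  "(complex ^ 'n \<Rightarrow> real) \<Rightarrow> complex ^ 'n \<Rightarrow> 'n::finite ctangent \<Rightarrow> complex" where
  "complex_hess f p v =
     (\<Sum>i\<in>UNIV. \<Sum>j\<in>UNIV.
        dz i (dzbar j (\<lambda>q. of_real (f q))) p * fst v $ i * cnj (fst v $ j))"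

subsection \<open>Domains\<close>

definition signed_distance :: "'a::metric_space set \<Rightarrow> 'a \<Rightarrow> real" where
  "signed_distance \<Omega> x =
     (if x \<in> \<Omega> then - infdist x (frontier \<Omega>) else infdist x (frontier \<Omega>))"

definition smooth_boundary :: "'a::real_normed_vector set \<Rightarrow> bool" where
  "smooth_boundary \<Omega> \<longleftrightarrow>
     (\<forall>p\<in>frontier \<Omega>. \<exists>U \<rho>. open U \<and> p \<in> U \<and> smooth_on U (\<rho> :: 'a \<Rightarrow> real) \<and>
        (\<forall>x\<in>U. frechet_derivative \<rho> (at x) \<noteq> (\<lambda>_. 0)) \<and>
        \<Omega> \<inter> U = {x\<in>U. \<rho> x < 0})"

text \<open>
  For a smooth boundary \<open>\<delta>\<close> has nonvanishing gradient on $\partial\Omega$, so the vectors \<open>v\<close> of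
  type \<open>(1,0)\<close> with $v\delta = 0$ form $T^{1,0}_p(\partial\Omega)$.
\<close>

definition tangent10 :: "(complex ^ 'n::finite) set \<Rightarrow> complex ^ 'n \<Rightarrow> 'n ctangent set" where
  "tangent10 \<Omega> p =
     {v. type10 v \<and> deriv_along v (\<lambda>q. of_real (signed_distance \<Omega> q)) p = 0}"

definition pseudoconvex :: "(complex ^ 'n::finite) set \<Rightarrow> bool" where
  "pseudoconvex \<Omega> \<longleftrightarrow>
     (\<forall>p\<in>frontier \<Omega>. \<forall>v\<in>tangent10 \<Omega> p. 0 \<le> complex_hess (signed_distance \<Omega>) p v)"

text \<open>$\Omega_{-\epsilon}$; for \<open>\<epsilon> = 0\<close> this is \<open>\<Omega>\<close> itself, so its frontier is $\partial\Omega$.\<close>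

definition inner_domain :: "'a::metric_space set \<Rightarrow> real \<Rightarrow> 'a set" where
  "inner_domain \<Omega> \<epsilon> = {x\<in>\<Omega>. signed_distance \<Omega> x \<le> - \<epsilon>}"

text \<open>A nonvanishing smooth field \<open>L\<close> of type \<open>(1,0)\<close> on the open set \<open>U\<close> with $L\delta = 0$ there.\<close>

definition tangential_field ::
  "(complex ^ 'n) set \<Rightarrow> (complex ^ 'n) set \<Rightarrow> (complex ^ 'n \<Rightarrow> 'n::finite ctangent) \<Rightarrow> bool" where
  "tangential_field \<Omega> U L \<longleftrightarrow> open U \<and> smooth_on U L \<and>
     (\<forall>q\<in>U. type10 (L q) \<and> L q \<noteq> 0 \<and>
        deriv_along (L q) (\<lambda>y. of_real (signed_distance \<Omega> y)) q = 0)"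

end

theory Submission
  imports Defs
begin

text \<open>
  Everything follows from how the Hessian of the signed distance $\delta$ changes along the normals
  of $\partial\Omega$. Near $\partial\Omega$ the function $\delta$ is smooth
  (\<open>signed_distance_tubular_neighborhood\<close>) and its gradient $n$ has length one. Write $H = Dn$ for
  the real Hessian. Differentiating $\langle n, n\rangle = 1$ once gives $Hn = 0$; differentiating
  $\langle Hu, n\rangle = 0$ again and using that second and third derivatives of $\delta$ are
  symmetric gives the Riccati equation $D_n H = -H^2$ (\<open>H_riccati\<close>).

  Let $J$ be multiplication by $i$ and $Q_x(u) = \langle H_x u, u\rangle +
  \langle H_x Ju, Ju\rangle$. For a field $L$ of type $(1,0)$ with coefficient vector $u$ one has
  $\mathrm{Hess}_\delta(L,L) = \frac14 Q(u)$, $N = \sqrt2\, n$,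
  $\langle\nabla_L N, L\rangle = \frac{\sqrt2}{4} Q(u)$, and $N + \overline N$ is $\sqrt2$ times the
  derivative in direction $n$. The condition $L\delta = 0$ says that $u$ and $Ju$ are orthogonal to $n$.

  First claim. By the Riccati equation, the derivative of $Q(u)$ in direction $n$ is
  $-|Hu|^2 - |HJu|^2$ plus twice the polar form of $Q$ at $u$ and $D_n u$. Since $Hn = 0$,
  differentiating $L\delta = 0$ along $n$ shows that $D_n u$ is again complex tangential. On the complex
  tangent space at a boundary point $Q \ge 0$ by pseudoconvexity, and $u$ is a null vector, so the polar
  form vanishes and only the nonpositive terms are left.

  Second claim. The gradient $n$ is constant along the segment from $p$ to $x$, so this segment is
  $\{p - \tau n(p)\}$ and all its points have the same complex tangent space. For a fixed tangential
  vector $v$ the Riccati equation makes $\tau \mapsto Q_{p - \tau n(p)}(v)$ nondecreasing, with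
  derivative $|Hv|^2 + |HJv|^2$, and at $\tau = 0$ it is nonnegative. If it vanishes at $\tau = s$, it
  vanishes on $[0,s]$, hence so does its derivative, and $Hv = HJv = 0$ at $x_s$. With $v$ the
  coefficient vector of $L$ at $x_s$ this says that $\nabla_L N = 0$ there, which is more than
  claimed; the endpoint $p$ follows by continuity.
\<close>

section \<open>Calculus of maps of class $C^k$\<close>
lemma Ck_on_cong_open:
  assumes "open S" "\<And>x. x \<in> S \<Longrightarrow> f x = g x" "Ck_on k S f"
  shows "Ck_on k S g"
  using assms(2,3)
proof (induction k arbitrary: f g)
  case 0
  then show ?case by (metis Ck_on.simps(1) continuous_on_cong)
next
  case (Suc k)
  have d: "(g has_derivative frechet_derivative f (at x)) (at x)" if "x \<in> S" for x
  proof (rule has_derivative_transform_within_open[OF _ assms(1) that])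
    show "(f has_derivative frechet_derivative f (at x)) (at x)"
      using Suc.prems(2) that by (simp add: frechet_derivative_works)
  qed (use Suc.prems(1) in auto)
  have "Ck_on k S (\<lambda>x. frechet_derivative g (at x) v)" for v
    using Suc.IH[of "\<lambda>x. frechet_derivative f (at x) v" "\<lambda>x. frechet_derivative g (at x) v"]
      Suc.prems(2) frechet_derivative_at[OF d] by simp
  then show ?case using d by (auto intro: differentiableI)
qed

lemma Ck_on_SucI:
  assumes "open S" "\<And>x. x \<in> S \<Longrightarrow> (f has_derivative F x) (at x)"
    and "\<And>v. Ck_on k S (\<lambda>x. F x v)"
  shows "Ck_on (Suc k) S f"
proof -
  have "Ck_on k S (\<lambda>x. frechet_derivative f (at x) v)" for v
    by (rule Ck_on_cong_open[OF assms(1) _ assms(3)])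
       (use assms(2) frechet_derivative_at in fastforce)
  then show ?thesis using assms(2) by (auto intro: differentiableI)
qed

lemma Ck_on_SucD:
  assumes "Ck_on (Suc k) S f"
  shows "x \<in> S \<Longrightarrow> (f has_derivative frechet_derivative f (at x)) (at x)"
    and "Ck_on k S (\<lambda>x. frechet_derivative f (at x) v)"
  using assms by (auto simp: frechet_derivative_works)

lemma Ck_on_lower: "Ck_on (Suc k) S f \<Longrightarrow> Ck_on k S f"
proof (induction k arbitrary: f)
  case 0
  then show ?case
    by (auto intro!: continuous_at_imp_continuous_on differentiable_imp_continuous_within)
qed (metis Ck_on.simps(2))

lemma Ck_on_imp_continuous_on: "Ck_on k S f \<Longrightarrow> continuous_on S f"
  by (induction k) (auto dest: Ck_on_lower simp del: Ck_on.simps(2))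

text \<open>
  Lets regularity that is known on small balls be glued along an infinite cover.
\<close>
lemma Ck_on_local:
  assumes "\<And>x. x \<in> S \<Longrightarrow> \<exists>T. open T \<and> x \<in> T \<and> Ck_on k T f"
  shows "Ck_on k S f"
  using assms
proof (induction k arbitrary: f)
  case 0
  then show ?case
    by (metis Ck_on.simps(1) continuous_at_imp_continuous_on continuous_on_eq_continuous_at)
next
  case (Suc k)
  have "Ck_on k S (\<lambda>x. frechet_derivative f (at x) v)" for v
    using Suc.IH Suc.prems by (metis Ck_on.simps(2))
  moreover have "f differentiable at x" if "x \<in> S" for x
    using Suc.prems[OF that] by auto
  ultimately show ?case by simp
qed

lemma Ck_on_const: "open S \<Longrightarrow> Ck_on k S (\<lambda>x. c)"
  by (induction k arbitrary: c)
     (auto intro!: Ck_on_SucI[where F = "\<lambda>_ _. 0"] simp del: Ck_on.simps(2))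

lemma Ck_on_bounded_linear:
  assumes "open S" "bounded_linear h" "Ck_on k S f"
  shows "Ck_on k S (\<lambda>x. h (f x))"
  using assms(3)
proof (induction k arbitrary: f)
  case 0
  then show ?case by (simp add: bounded_linear.continuous_on[OF assms(2)])
next
  case (Suc k)
  show ?case
    by (rule Ck_on_SucI[OF assms(1) bounded_linear.has_derivative[OF assms(2)]])
       (use Suc Ck_on_SucD[OF Suc.prems] in auto)
qed

lemma Ck_on_ident: "open S \<Longrightarrow> Ck_on k S (\<lambda>x. x)"
  by (cases k) (auto intro!: Ck_on_SucI Ck_on_const has_derivative_ident simp del: Ck_on.simps(2))

lemma Ck_on_add:
  assumes "open S" "Ck_on k S f" "Ck_on k S g"
  shows "Ck_on k S (\<lambda>x. f x + g x)"
  using assms(2,3)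
proof (induction k arbitrary: f g)
  case 0
  then show ?case by (simp add: continuous_on_add)
next
  case (Suc k)
  note f = Ck_on_SucD[OF Suc.prems(1)] and g = Ck_on_SucD[OF Suc.prems(2)]
  show ?case
    by (rule Ck_on_SucI[OF assms(1) has_derivative_add[OF f(1) g(1)]])
       (auto intro: Suc.IH f(2) g(2))
qed

lemma Ck_on_sum:
  assumes "open S" "\<And>i. i \<in> I \<Longrightarrow> Ck_on k S (f i)"
  shows "Ck_on k S (\<lambda>x. \<Sum>i\<in>I. f i x)"
  using assms(2)
  by (induction I rule: infinite_finite_induct) (auto intro: Ck_on_add Ck_on_const assms(1))

lemma Ck_on_bilinear:
  assumes "open S" "bounded_bilinear h" "Ck_on k S f" "Ck_on k S g"
  shows "Ck_on k S (\<lambda>x. h (f x) (g x))"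
  using assms(3,4)
proof (induction k arbitrary: f g)
  case 0
  then show ?case by (simp add: bounded_bilinear.continuous_on[OF assms(2)])
next
  case (Suc k)
  note f = Ck_on_SucD[OF Suc.prems(1)] and g = Ck_on_SucD[OF Suc.prems(2)]
  show ?case
    by (rule Ck_on_SucI[OF assms(1) bounded_bilinear.FDERIV[OF assms(2) f(1) g(1)]])
       (auto intro!: Ck_on_add assms(1) Suc.IH f(2) g(2) Ck_on_lower[OF Suc.prems(1)]
          Ck_on_lower[OF Suc.prems(2)])
qed

lemma linear_Basis_expansion:
  fixes D :: "'a::euclidean_space \<Rightarrow> 'b::real_vector"
  assumes "linear D"
  shows "D v = (\<Sum>b\<in>Basis. (v \<bullet> b) *\<^sub>R D b)"
proof -
  have "D v = D (\<Sum>b\<in>Basis. (v \<bullet> b) *\<^sub>R b)" by (simp only: euclidean_representation)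
  then show ?thesis by (simp only: linear_sum[OF assms] linear_scale[OF assms])
qed

text \<open>
  By the chain rule the derivative of the composition in direction \<open>v\<close> is a linear combination, with
  coefficients depending on the inner map, of the derivatives of the outer map in the basis directions.
  Expanding in a basis keeps the value types unchanged, so that the induction hypothesis applies to each
  summand.
\<close>
lemma Ck_on_compose:
  fixes f :: "'a::real_normed_vector \<Rightarrow> 'b::euclidean_space"
  assumes "open S" "open T" "f ` S \<subseteq> T" "Ck_on k T g" "Ck_on k S f"
  shows "Ck_on k S (\<lambda>x. g (f x))"
  using assms(4,5)
proof (induction k arbitrary: g)
  case 0
  then show ?case using assms(3) by (auto intro: continuous_on_compose2)
next
  case (Suc k)
  note g = Ck_on_SucD[OF Suc.prems(1)] and f = Ck_on_SucD[OF Suc.prems(2)]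
  define F where "F x v = (\<Sum>b\<in>Basis.
    (frechet_derivative f (at x) v \<bullet> b) *\<^sub>R frechet_derivative g (at (f x)) b)" for x v
  show ?case
  proof (rule Ck_on_SucI[OF assms(1)])
    fix x assume x: "x \<in> S"
    have lin: "linear (frechet_derivative g (at (f x)))"
      using g(1)[of "f x"] x assms(3) has_derivative_linear by blast
    have "F x = (\<lambda>v. frechet_derivative g (at (f x)) (frechet_derivative f (at x) v))"
      unfolding F_def by (intro ext linear_Basis_expansion[OF lin, symmetric])
    then show "((\<lambda>x. g (f x)) has_derivative F x) (at x)"
      using has_derivative_compose[OF f(1)[OF x] g(1)[of "f x"]] x assms(3) by auto
  next
    show "Ck_on k S (\<lambda>x. F x v)" for v
      unfolding F_def
      by (intro Ck_on_sum assms(1) Ck_on_bilinear[OF _ bounded_bilinear_scaleR]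
          Ck_on_bounded_linear[OF _ bounded_linear_inner_left] f(2) Suc.IH g(2)
          Ck_on_lower[OF Suc.prems(2)])
  qed
qed

text \<open>
  The exponent is generalized because differentiation lowers it; the case of exponent $-\frac12$
  serves to normalize a nonvanishing vector field.
\<close>
lemma Ck_on_powr: "Ck_on k {0<..} (\<lambda>x::real. x powr a)"
proof (induction k arbitrary: a)
  case 0
  then show ?case by (auto intro!: continuous_intros)
next
  case (Suc k)
  show ?case
  proof (rule Ck_on_SucI)
    fix x :: real assume "x \<in> {0<..}"
    then have "((\<lambda>x. x powr a) has_real_derivative a * x powr (a - 1)) (at x)"
      by (auto intro: has_real_derivative_powr)
    then show "((\<lambda>x. x powr a) has_derivative (\<lambda>h. a * x powr (a - 1) * h)) (at x)"
      by (simp add: has_field_derivative_def)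
  next
    show "Ck_on k {0<..} (\<lambda>x. a * x powr (a - 1) * v)" for v
      by (intro Ck_on_bilinear[OF _ bounded_bilinear_mult] Ck_on_const Suc.IH) auto
  qed auto
qed

text \<open>
  The derivative of a local inverse is the pointwise inverse of the derivative, and inversion acts on
  operators; the derivative is therefore needed as one operator-valued map and not only direction by
  direction. It is assembled from its values on a basis.
\<close>
lemma Ck_on_blinfun_derivative:
  fixes f :: "'a::euclidean_space \<Rightarrow> 'b::real_normed_vector"
  assumes "open S" "Ck_on (Suc k) S f"
  obtains F :: "'a \<Rightarrow> 'a \<Rightarrow>\<^sub>L 'b"
  where "\<And>x. x \<in> S \<Longrightarrow> (f has_derivative blinfun_apply (F x)) (at x)" "Ck_on k S F"
proof -
  note f = Ck_on_SucD[OF assms(2)]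
  define E :: "'a \<Rightarrow> 'b \<Rightarrow> 'a \<Rightarrow>\<^sub>L 'b" where
    "E b c = blinfun_scaleR_left c o\<^sub>L blinfun_inner_right b" for b c
  have E: "bounded_linear (E b)" for b
    unfolding E_def
    by (intro bounded_linear_compose[OF bounded_bilinear.bounded_linear_left
          [OF bounded_bilinear_blinfun_compose]] bounded_linear_blinfun_scaleR_left)
  define F where "F x = (\<Sum>b\<in>Basis. E b (frechet_derivative f (at x) b))" for x
  show thesis
  proof
    fix x assume x: "x \<in> S"
    have lin: "linear (frechet_derivative f (at x))"
      using f(1)[OF x] has_derivative_linear by blast
    have "blinfun_apply (F x) = frechet_derivative f (at x)"
    proof
      show "blinfun_apply (F x) v = frechet_derivative f (at x) v" for v
        using linear_Basis_expansion[OF lin, of v]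
        by (simp add: F_def E_def blinfun.sum_left inner_commute)
    qed
    then show "(f has_derivative blinfun_apply (F x)) (at x)" using f(1)[OF x] by simp
  next
    show "Ck_on k S F"
      unfolding F_def by (intro Ck_on_sum assms(1) Ck_on_bounded_linear[OF _ E] f(2))
  qed
qed

text \<open>
  The formula for the derivative is the linearization of the resolvent identity
  \<open>A y - A x = - A y (B y - B x) A x\<close>; continuity of \<open>A\<close> controls the error.
\<close>
lemma has_derivative_blinfun_inverse:
  fixes A :: "'a::real_normed_vector \<Rightarrow> 'b::real_normed_vector \<Rightarrow>\<^sub>L 'c::real_normed_vector"
    and B :: "'a \<Rightarrow> 'c \<Rightarrow>\<^sub>L 'b"
  assumes S: "open S" "x \<in> S"
    and inv: "\<And>y. y \<in> S \<Longrightarrow> A y o\<^sub>L B y = id_blinfun" "\<And>y. y \<in> S \<Longrightarrow> B y o\<^sub>L A y = id_blinfun"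
    and A: "continuous (at x) A" and B: "(B has_derivative B') (at x)"
  shows "(A has_derivative (\<lambda>h. - (A x o\<^sub>L B' h o\<^sub>L A x))) (at x)"
proof -
  have lin: "bounded_linear B'" using B by (rule has_derivative_bounded_linear)
  obtain K where K: "norm (B' h) \<le> norm h * K" for h
    using bounded_linear.bounded[OF lin] by blast
  have bl: "bounded_linear (\<lambda>h. - (A x o\<^sub>L B' h o\<^sub>L A x))"
    by (intro bounded_linear_minus bounded_linear_compose[OF bounded_bilinear.bounded_linear_left
          [OF bounded_bilinear_blinfun_compose]] bounded_linear_compose[OF
          bounded_bilinear.bounded_linear_right[OF bounded_bilinear_blinfun_compose]] lin)
  define e where "e y = norm (B y - B x - B' (y - x)) / norm (y - x)" for y
  define R where "R y = norm (A y) * e y * norm (A x) + norm (A y - A x) * K * norm (A x)" for y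
  have e: "(e \<longlongrightarrow> 0) (at x)"
    using B unfolding has_derivative_iff_norm e_def by auto
  have Ax: "(A \<longlongrightarrow> A x) (at x)" using A by (simp add: continuous_at)
  have Ad: "((\<lambda>y. norm (A y - A x)) \<longlongrightarrow> 0) (at x)"
    using tendsto_norm[OF tendsto_diff[OF Ax tendsto_const[of "A x"]]] by simp
  have "(R \<longlongrightarrow> norm (A x) * 0 * norm (A x) + 0 * K * norm (A x)) (at x)"
    unfolding R_def by (intro tendsto_intros tendsto_norm Ax e Ad)
  then have R: "(R \<longlongrightarrow> 0) (at x)" by simp
  have "norm (norm (A y - A x - - (A x o\<^sub>L B' (y - x) o\<^sub>L A x)) / norm (y - x)) \<le> R y"
    if y: "y \<in> S" "y \<noteq> x" for y
  proof -
    have "A y - A x - - (A x o\<^sub>L B' (y - x) o\<^sub>L A x) =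
       - (A y o\<^sub>L (B y - B x - B' (y - x)) o\<^sub>L A x) - ((A y - A x) o\<^sub>L B' (y - x) o\<^sub>L A x)"
    proof (rule blinfun_eqI)
      fix w
      have "A y (B y (A x w)) = A x w" "B x (A x w) = w"
        using inv(1)[OF y(1)] inv(2)[OF S(2)]
        by (metis blinfun_apply_blinfun_compose blinfun_apply_id_blinfun)+
      then show "(A y - A x - - (A x o\<^sub>L B' (y - x) o\<^sub>L A x)) w =
        (- (A y o\<^sub>L (B y - B x - B' (y - x)) o\<^sub>L A x) - ((A y - A x) o\<^sub>L B' (y - x) o\<^sub>L A x)) w"
        by (simp add: blinfun.bilinear_simps)
    qed
    then have "norm (A y - A x - - (A x o\<^sub>L B' (y - x) o\<^sub>L A x)) \<le>
       norm (A y o\<^sub>L (B y - B x - B' (y - x)) o\<^sub>L A x) + norm ((A y - A x) o\<^sub>L B' (y - x) o\<^sub>L A x)"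
      by (metis norm_minus_cancel norm_triangle_ineq4)
    also have "\<dots> \<le> norm (A y) * norm (B y - B x - B' (y - x)) * norm (A x) +
        norm (A y - A x) * norm (B' (y - x)) * norm (A x)"
      by (intro add_mono order_trans[OF norm_blinfun_compose] mult_right_mono
          norm_blinfun_compose norm_ge_zero)
    also have "\<dots> \<le> norm (A y) * norm (B y - B x - B' (y - x)) * norm (A x) +
        norm (A y - A x) * (norm (y - x) * K) * norm (A x)"
      by (intro add_left_mono mult_right_mono mult_left_mono K norm_ge_zero)
    also have "\<dots> = R y * norm (y - x)"
      using y(2) by (simp add: R_def e_def field_simps)
    finally show ?thesis using y(2) by (simp add: divide_le_eq)
  qed
  then have "\<forall>\<^sub>F y in at x. norm (norm (A y - A x - - (A x o\<^sub>L B' (y - x) o\<^sub>L A x)) / norm (y - x)) \<le> R y"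
    using S by (auto simp: eventually_at_topological)
  from Lim_null_comparison[OF this R] bl show ?thesis
    unfolding has_derivative_iff_norm by simp
qed

text \<open>
  The resolvent identity \<open>A y - A x = - A y (B y - B x) A x\<close> first bounds \<open>A y\<close> near \<open>x\<close> by
  \<open>2 norm (A x)\<close> and then makes the difference small.
\<close>
lemma continuous_on_blinfun_inverse:
  fixes A :: "'a::topological_space \<Rightarrow> 'b::real_normed_vector \<Rightarrow>\<^sub>L 'c::real_normed_vector"
  assumes inv: "\<And>y. y \<in> S \<Longrightarrow> A y o\<^sub>L B y = id_blinfun"
      "\<And>y. y \<in> S \<Longrightarrow> B y o\<^sub>L A y = id_blinfun"
    and B: "continuous_on S B"
  shows "continuous_on S A"
  unfolding continuous_on_def
proof
  fix x assume x: "x \<in> S"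
  define d where "d y = norm (B y - B x)" for y
  have Bx: "(B \<longlongrightarrow> B x) (at x within S)" using B x by (simp add: continuous_on_def)
  have d: "(d \<longlongrightarrow> 0) (at x within S)"
    using tendsto_norm[OF tendsto_diff[OF Bx tendsto_const[of "B x"]]] by (simp add: d_def[abs_def])
  then have "((\<lambda>y. d y * norm (A x)) \<longlongrightarrow> 0 * norm (A x)) (at x within S)"
    by (intro tendsto_intros)
  then have small: "\<forall>\<^sub>F y in at x within S. d y * norm (A x) < 1 / 2"
    by (intro order_tendstoD(2)[where a = "1/2"]) auto
  have bound: "norm (A y - A x) \<le> 2 * norm (A x) * d y * norm (A x)"
    if y: "y \<in> S" "d y * norm (A x) < 1 / 2" for y
  proof -
    have "A y - A x = - (A y o\<^sub>L (B y - B x) o\<^sub>L A x)"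
    proof (rule blinfun_eqI)
      fix w
      have "A y (B y (A x w)) = A x w" "B x (A x w) = w"
        using inv(1)[OF y(1)] inv(2)[OF x]
        by (metis blinfun_apply_blinfun_compose blinfun_apply_id_blinfun)+
      then show "(A y - A x) w = (- (A y o\<^sub>L (B y - B x) o\<^sub>L A x)) w"
        by (simp add: blinfun.bilinear_simps)
    qed
    then have "norm (A y - A x) = norm (A y o\<^sub>L (B y - B x) o\<^sub>L A x)" by simp
    also have "\<dots> \<le> norm (A y) * d y * norm (A x)"
      unfolding d_def
      by (intro order_trans[OF norm_blinfun_compose] mult_right_mono norm_blinfun_compose norm_ge_zero)
    finally have le: "norm (A y - A x) \<le> norm (A y) * d y * norm (A x)" .
    have "norm (A y) * (d y * norm (A x)) \<le> norm (A y) * (1 / 2)"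
      using y(2) by (intro mult_left_mono) auto
    with le have "norm (A y) \<le> 2 * norm (A x)"
      using norm_triangle_sub[of "A y" "A x"] by (simp add: mult.assoc)
    then have "norm (A y) * d y * norm (A x) \<le> 2 * norm (A x) * d y * norm (A x)"
      by (intro mult_right_mono) (auto simp: d_def)
    with le show ?thesis by linarith
  qed
  have "((\<lambda>y. 2 * norm (A x) * d y * norm (A x)) \<longlongrightarrow> 2 * norm (A x) * 0 * norm (A x)) (at x within S)"
    by (intro tendsto_intros d)
  then have z: "((\<lambda>y. 2 * norm (A x) * d y * norm (A x)) \<longlongrightarrow> 0) (at x within S)" by simp
  have "\<forall>\<^sub>F y in at x within S. y \<in> S" by (auto simp: eventually_at_filter)
  with small have "\<forall>\<^sub>F y in at x within S. norm (A y - A x) \<le> 2 * norm (A x) * d y * norm (A x)"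
    by eventually_elim (use bound in auto)
  from Lim_null_comparison[OF this z]
  show "(A \<longlongrightarrow> A x) (at x within S)" by (simp add: LIM_zero_iff)
qed

text \<open>
  The derivative of \<open>A\<close> is a product of \<open>A\<close> and the derivative of \<open>B\<close>, so each order of regularity
  of \<open>A\<close> yields the next one.
\<close>
lemma Ck_on_blinfun_inverse:
  fixes A :: "'a::real_normed_vector \<Rightarrow> 'b::real_normed_vector \<Rightarrow>\<^sub>L 'c::real_normed_vector"
  assumes "open S" "\<And>y. y \<in> S \<Longrightarrow> A y o\<^sub>L B y = id_blinfun" "\<And>y. y \<in> S \<Longrightarrow> B y o\<^sub>L A y = id_blinfun"
    and "Ck_on k S B"
  shows "Ck_on k S A"
  using assms(4)
proof (induction k)
  case 0
  then show ?case using continuous_on_blinfun_inverse[OF assms(2,3)] by simp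
next
  case (Suc k)
  note B = Ck_on_SucD[OF Suc.prems]
  have A: "Ck_on k S A" using Suc Ck_on_lower by blast
  show ?case
  proof (rule Ck_on_SucI[OF assms(1)])
    fix x assume x: "x \<in> S"
    then have "continuous (at x) A"
      using assms(1) Ck_on_imp_continuous_on[OF A] continuous_on_eq_continuous_at by blast
    then show "(A has_derivative (\<lambda>h. - (A x o\<^sub>L frechet_derivative B (at x) h o\<^sub>L A x))) (at x)"
      by (intro has_derivative_blinfun_inverse[where S = S and B = B] assms x B(1))
  next
    show "Ck_on k S (\<lambda>x. - (A x o\<^sub>L frechet_derivative B (at x) v o\<^sub>L A x))" for v
      by (intro Ck_on_bounded_linear[OF _ bounded_linear_minus[OF bounded_linear_ident]]
          Ck_on_bilinear[OF _ bounded_bilinear_blinfun_compose] assms(1) A B(2))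
  qed
qed

text \<open>
  The inverse function theorem gives a differentiable local inverse \<open>g\<close> whose derivative at \<open>y\<close> is the
  inverse of \<open>f' (g y)\<close>. Hence \<open>g\<close> gains one order of differentiability each time this formula is read
  with the regularity of \<open>g\<close> that is already known.
\<close>
lemma smooth_inverse_function:
  fixes f :: "'a::euclidean_space \<Rightarrow> 'a"
  assumes "open S" "x0 \<in> S" "smooth_on S f"
    and inj: "\<And>v. frechet_derivative f (at x0) v = 0 \<Longrightarrow> v = 0"
  obtains U V g where "open U" "U \<subseteq> S" "x0 \<in> U" "open V" "f x0 \<in> V"
    "homeomorphism U V f g" "smooth_on V g"
proof -
  obtain F where F: "\<And>x. x \<in> S \<Longrightarrow> (f has_derivative blinfun_apply (F x)) (at x)"
    and "Ck_on 0 S F"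
    using Ck_on_blinfun_derivative[OF assms(1), of 0 f] assms(3) unfolding smooth_on_def by metis
  have Fk: "Ck_on k S F" for k
  proof -
    obtain F' where F': "\<And>x. x \<in> S \<Longrightarrow> (f has_derivative blinfun_apply (F' x)) (at x)"
      and "Ck_on k S F'"
      using Ck_on_blinfun_derivative[OF assms(1), of k f] assms(3) unfolding smooth_on_def by metis
    have "F' x = F x" if "x \<in> S" for x
      using has_derivative_unique[OF F[OF that] F'[OF that]] by (simp add: blinfun_apply_inject)
    then show ?thesis using Ck_on_cong_open[OF assms(1) _ \<open>Ck_on k S F'\<close>] by blast
  qed
  have "inj (blinfun_apply (F x0))"
    unfolding linear_injective_0[OF bounded_linear.linear[OF blinfun.bounded_linear_right]]
    using inj frechet_derivative_at[OF F[OF assms(2)]] by simp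
  then obtain h where h: "linear h" "h \<circ> blinfun_apply (F x0) = id"
    using linear_injective_left_inverse bounded_linear.linear[OF blinfun.bounded_linear_right]
    by blast
  have "Blinfun h o\<^sub>L F x0 = id_blinfun"
    using h by (intro blinfun_eqI)
      (simp add: bounded_linear_Blinfun_apply linear_conv_bounded_linear fun_eq_iff)
  from inverse_function_theorem[OF assms(1) F Ck_on_imp_continuous_on[OF Fk[of 0]] assms(2) this]
  obtain U V g g' where UV: "open U" "U \<subseteq> S" "x0 \<in> U" "open V" "f x0 \<in> V" "homeomorphism U V f g"
    and g: "\<And>y. y \<in> V \<Longrightarrow> (g has_derivative (g' y)) (at y)"
    "\<And>y. y \<in> V \<Longrightarrow> g' y = inv (blinfun_apply (F (g y)))"
    "\<And>y. y \<in> V \<Longrightarrow> bij (blinfun_apply (F (g y)))"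
    by metis
  have gS: "g ` V \<subseteq> S" using UV(2,6) by (auto simp: homeomorphism_def)
  define A where "A y = Blinfun (g' y)" for y
  have A: "blinfun_apply (A y) = g' y" if "y \<in> V" for y
    unfolding A_def using g(1)[OF that] has_derivative_bounded_linear bounded_linear_Blinfun_apply
    by blast
  have AB: "A y o\<^sub>L F (g y) = id_blinfun" "F (g y) o\<^sub>L A y = id_blinfun" if "y \<in> V" for y
    using A[OF that] g(2,3)[OF that]
    by (auto intro!: blinfun_eqI simp: bij_is_inj bij_is_surj surj_f_inv_f)
  have gc: "continuous_on V g" using UV(6) by (simp add: homeomorphism_def)
  have "Ck_on k V g" for k
  proof (induction k)
    case 0
    then show ?case using gc by simp
  next
    case (Suc k)
    have "Ck_on k V (\<lambda>y. F (g y))"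
      by (rule Ck_on_compose[OF UV(4) assms(1) gS Fk Suc])
    from Ck_on_blinfun_inverse[where B = "\<lambda>y. F (g y)", OF UV(4) AB this]
    have "Ck_on k V A" by auto
    then have "Ck_on k V (\<lambda>y. blinfun_apply (A y) v)" for v
      by (intro Ck_on_bilinear[OF UV(4) bounded_bilinear_blinfun_apply] Ck_on_const[OF UV(4)])
    then show ?case
      by (intro Ck_on_SucI[OF UV(4), of g "\<lambda>y. blinfun_apply (A y)"]) (simp_all add: A g(1))
  qed
  then show thesis using that[OF UV] unfolding smooth_on_def by blast
qed

section \<open>Symmetry of second derivatives\<close>
lemma has_vector_derivative_along_line:
  assumes "(f has_derivative D) (at (a + s *\<^sub>R v))"
  shows "((\<lambda>s. f (a + s *\<^sub>R v)) has_vector_derivative D v) (at s within X)"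
proof -
  have "((\<lambda>s. a + s *\<^sub>R v) has_derivative (\<lambda>r. r *\<^sub>R v)) (at s within X)"
    by (auto intro!: derivative_eq_intros)
  from has_derivative_compose[OF this, of f D] assms
  have "((\<lambda>s. f (a + s *\<^sub>R v)) has_derivative (\<lambda>r. D (r *\<^sub>R v))) (at s within X)" by simp
  then show ?thesis
    using linear_scale[OF has_derivative_linear[OF assms]] by (simp add: has_vector_derivative_def)
qed

lemma has_real_derivative_along_line:
  assumes "(f has_derivative D) (at (a + s *\<^sub>R v))"
  shows "((\<lambda>s. f (a + s *\<^sub>R v)) has_real_derivative D v) (at s within X)"
  using has_vector_derivative_along_line[OF assms]
  by (simp add: has_real_derivative_iff_has_vector_derivative)

text \<open>
  The mean value theorem, first in direction \<open>v\<close> and then in direction \<open>w\<close>, turns the quotient into a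
  second derivative at an intermediate point, which is continuous.
\<close>
lemma second_difference_tendsto:
  fixes f :: "'a::real_normed_vector \<Rightarrow> real"
  assumes "open S" "x \<in> S" and f: "Ck_on (Suc (Suc 0)) S f"
  shows "((\<lambda>h. (f (x + h *\<^sub>R v + h *\<^sub>R w) - f (x + h *\<^sub>R v) - f (x + h *\<^sub>R w) + f x) / (h * h))
    \<longlongrightarrow> frechet_derivative (\<lambda>y. frechet_derivative f (at y) v) (at x) w) (at_right 0)"
proof (rule tendstoI)
  fix e :: real assume "e > 0"
  define g where "g y = frechet_derivative f (at y) v" for y
  define G where "G y = frechet_derivative g (at y) w" for y
  have g: "Ck_on (Suc 0) S g" unfolding g_def by (rule Ck_on_SucD(2)[OF f])
  have "continuous_on S G"
    using Ck_on_SucD(2)[OF g] by (simp add: G_def[abs_def])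
  then obtain d1 where d1: "d1 > 0" "\<And>z. z \<in> S \<Longrightarrow> dist z x < d1 \<Longrightarrow> dist (G z) (G x) < e"
    using assms(2) \<open>e > 0\<close> unfolding continuous_on_iff by metis
  obtain d2 where d2: "d2 > 0" "ball x d2 \<subseteq> S" using assms(1,2) openE by blast
  define d where "d = min d1 d2"
  have d: "d > 0" "\<And>z. dist z x < d \<Longrightarrow> z \<in> S \<and> dist (G z) (G x) < e"
    using d1 d2 by (auto simp: d_def subset_iff dist_commute)
  \<comment> \<open>The summand 1 avoids division by zero.\<close>
  define h0 where "h0 = d / (norm v + norm w + 1)"
  have nz: "norm v + norm w + 1 > 0" by (simp add: add_nonneg_pos)
  have "h0 > 0" using d(1) nz by (simp add: h0_def)
  have main: "dist ((f (x + h *\<^sub>R v + h *\<^sub>R w) - f (x + h *\<^sub>R v) - f (x + h *\<^sub>R w) + f x) / (h * h)) (G x) < e"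
    if h: "0 < h" "h < h0" for h
  proof -
    have near: "dist (x + s *\<^sub>R v + t *\<^sub>R w) x < d" if "0 \<le> s" "s \<le> h" "0 \<le> t" "t \<le> h" for s t
    proof -
      have "dist (x + s *\<^sub>R v + t *\<^sub>R w) x \<le> s * norm v + t * norm w"
        using norm_triangle_ineq[of "s *\<^sub>R v" "t *\<^sub>R w"] that by (simp add: dist_norm add.assoc)
      also have "\<dots> \<le> h * norm v + h * norm w"
        using that by (intro add_mono mult_right_mono) auto
      also have "\<dots> \<le> h * (norm v + norm w + 1)" using h by (simp add: algebra_simps)
      also have "\<dots> < d" using h nz by (simp add: h0_def field_simps)
      finally show ?thesis .
    qed
    have f': "((\<lambda>s. f (x + s *\<^sub>R v + t *\<^sub>R w)) has_real_derivative g (x + s *\<^sub>R v + t *\<^sub>R w)) (at s)"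
      if "0 \<le> s" "s \<le> h" "0 \<le> t" "t \<le> h" for s t
      using has_real_derivative_along_line[of f _ "x + t *\<^sub>R w" s v] Ck_on_SucD(1)[OF f] d(2)[OF near[OF that]]
      by (simp add: g_def ac_simps)
    have g': "((\<lambda>t. g (x + s *\<^sub>R v + t *\<^sub>R w)) has_real_derivative G (x + s *\<^sub>R v + t *\<^sub>R w)) (at t)"
      if "0 \<le> s" "s \<le> h" "0 \<le> t" "t \<le> h" for s t
      using has_real_derivative_along_line[of g _ "x + s *\<^sub>R v" t w] Ck_on_SucD(1)[OF g] d(2)[OF near[OF that]]
      by (simp add: G_def ac_simps)
    define \<phi> where "\<phi> s = f (x + s *\<^sub>R v + h *\<^sub>R w) - f (x + s *\<^sub>R v + 0 *\<^sub>R w)" for s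
    have "(\<phi> has_real_derivative g (x + s *\<^sub>R v + h *\<^sub>R w) - g (x + s *\<^sub>R v + 0 *\<^sub>R w)) (at s)"
      if "0 \<le> s" "s \<le> h" for s
      unfolding \<phi>_def using that h(1) by (intro DERIV_diff f') auto
    from MVT2[OF h(1) this] obtain s where s: "0 < s" "s < h"
      "\<phi> h - \<phi> 0 = h * (g (x + s *\<^sub>R v + h *\<^sub>R w) - g (x + s *\<^sub>R v + 0 *\<^sub>R w))" by auto
    obtain t where t: "0 < t" "t < h"
      "g (x + s *\<^sub>R v + h *\<^sub>R w) - g (x + s *\<^sub>R v + 0 *\<^sub>R w) = h * G (x + s *\<^sub>R v + t *\<^sub>R w)"
      using MVT2[OF h(1) g'[of s]] s by auto
    have "(f (x + h *\<^sub>R v + h *\<^sub>R w) - f (x + h *\<^sub>R v) - f (x + h *\<^sub>R w) + f x) / (h * h)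
        = G (x + s *\<^sub>R v + t *\<^sub>R w)"
      using s(3) t(3) h(1) by (simp add: \<phi>_def field_simps)
    then show ?thesis using d(2)[OF near[of s t]] s t by simp
  qed
  show "\<forall>\<^sub>F h in at_right 0. dist ((f (x + h *\<^sub>R v + h *\<^sub>R w) - f (x + h *\<^sub>R v) - f (x + h *\<^sub>R w) + f x) / (h * h))
     (frechet_derivative (\<lambda>y. frechet_derivative f (at y) v) (at x) w) < e"
    using main \<open>h0 > 0\<close> unfolding eventually_at_right_field G_def g_def by blast
qed

text \<open>
  The second difference does not change when \<open>v\<close> and \<open>w\<close> are exchanged.
\<close>
lemma second_derivative_symmetric:
  fixes f :: "'a::real_normed_vector \<Rightarrow> real"
  assumes "open S" "x \<in> S" "Ck_on (Suc (Suc 0)) S f"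
  shows "frechet_derivative (\<lambda>y. frechet_derivative f (at y) v) (at x) w =
    frechet_derivative (\<lambda>y. frechet_derivative f (at y) w) (at x) v"
proof (rule tendsto_unique[OF _ second_difference_tendsto[OF assms]])
  show "((\<lambda>h. (f (x + h *\<^sub>R v + h *\<^sub>R w) - f (x + h *\<^sub>R v) - f (x + h *\<^sub>R w) + f x) / (h * h))
    \<longlongrightarrow> frechet_derivative (\<lambda>y. frechet_derivative f (at y) w) (at x) v) (at_right 0)"
    using second_difference_tendsto[OF assms, of w v] by (simp add: algebra_simps)
qed simp

section \<open>Gradients and nearest boundary points\<close>
definition gradient :: "('a::euclidean_space \<Rightarrow> real) \<Rightarrow> 'a \<Rightarrow> 'a" where
  "gradient f x = (\<Sum>b\<in>Basis. frechet_derivative f (at x) b *\<^sub>R b)"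

lemma gradient_unique:
  assumes "(f has_derivative (\<lambda>v. n \<bullet> v)) (at x)"
  shows "gradient f x = n"
  using frechet_derivative_at[OF assms, symmetric]
  by (simp add: gradient_def euclidean_representation)

lemma has_derivative_gradient:
  assumes "f differentiable (at x)"
  shows "(f has_derivative (\<lambda>v. gradient f x \<bullet> v)) (at x)"
proof -
  have lin: "linear (frechet_derivative f (at x))"
    using assms has_derivative_linear frechet_derivative_works by blast
  have "frechet_derivative f (at x) v = gradient f x \<bullet> v" for v
    unfolding linear_Basis_expansion[OF lin, of v]
    by (simp add: gradient_def inner_sum_left inner_sum_right inner_commute mult.commute)
  then have "frechet_derivative f (at x) = (\<lambda>v. gradient f x \<bullet> v)" by auto
  with assms show ?thesis by (simp add: frechet_derivative_works)
qed

lemma Ck_on_gradient: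
  assumes "open S" "Ck_on (Suc k) S f"
  shows "Ck_on k S (gradient f)"
  unfolding gradient_def[abs_def]
  by (intro Ck_on_sum assms(1) Ck_on_bilinear[OF _ bounded_bilinear_scaleR] Ck_on_const
      Ck_on_SucD(2)[OF assms(2)])

text \<open>
  A linear form that is nonpositive on a half-space is a nonpositive multiple of the form defining it.
  The sum of the two unit normals contradicts the hypothesis unless equality holds in the
  Cauchy-Schwarz inequality.
\<close>
lemma antiparallelI:
  fixes w z :: "'a::real_inner"
  assumes "z \<noteq> 0" "w \<noteq> 0" "\<And>v. v \<bullet> z > 0 \<Longrightarrow> w \<bullet> v \<le> 0"
  shows "z = - (norm z / norm w) *\<^sub>R w"
proof -
  define v where "v = (1 / norm w) *\<^sub>R w + (1 / norm z) *\<^sub>R z"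
  have vz: "v \<bullet> z = (w \<bullet> z) / norm w + norm z"
    using assms by (simp add: v_def inner_add_left inner_same_Basis flip: power2_norm_eq_inner)
       (simp add: power2_eq_square)
  have wv: "w \<bullet> v = norm w + (w \<bullet> z) / norm z"
    using assms by (simp add: v_def inner_add_right flip: power2_norm_eq_inner)
       (simp add: power2_eq_square)
  have "w \<bullet> z \<le> - (norm w * norm z)"
  proof (rule ccontr)
    assume "\<not> w \<bullet> z \<le> - (norm w * norm z)"
    then have gt: "w \<bullet> z + norm w * norm z > 0" by simp
    have "v \<bullet> z = (w \<bullet> z + norm w * norm z) / norm w" using assms vz by (simp add: field_simps)
    then have "v \<bullet> z > 0" using gt assms by simp
    then have "w \<bullet> v \<le> 0" by (rule assms(3))
    moreover have "w \<bullet> v = (w \<bullet> z + norm w * norm z) / norm z" using assms wv by (simp add: field_simps)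
    ultimately show False using gt assms by (simp add: divide_le_0_iff)
  qed
  moreover have "- (w \<bullet> z) \<le> norm w * norm z"
    using norm_cauchy_schwarz[of w "- z"] by simp
  ultimately have "w \<bullet> (- z) = norm w * norm (- z)" by simp
  then have "norm w *\<^sub>R (- z) = norm z *\<^sub>R w"
    using norm_cauchy_schwarz_eq[of w "- z"] by simp
  then have "(1 / norm w) *\<^sub>R (norm w *\<^sub>R (- z)) = (1 / norm w) *\<^sub>R (norm z *\<^sub>R w)" by (simp only:)
  then have "- z = (norm z / norm w) *\<^sub>R w" using assms(2) by simp
  then show ?thesis by (metis add.inverse_inverse scaleR_minus_left)
qed

lemma directional_derivative_nonpos:
  fixes f :: "'a::real_normed_vector \<Rightarrow> real"
  assumes "(f has_derivative D) (at q)" "\<forall>\<^sub>F t in at_right 0. f (q + t *\<^sub>R v) \<le> f q"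
  shows "D v \<le> 0"
proof (rule ccontr)
  assume "\<not> D v \<le> 0"
  moreover have "((\<lambda>t. f (q + t *\<^sub>R v)) has_real_derivative D v) (at 0)"
    using has_real_derivative_along_line[of f D q 0 v UNIV] assms(1) by simp
  ultimately obtain d where d: "d > 0" "\<And>h. h > 0 \<Longrightarrow> h < d \<Longrightarrow> f q < f (q + h *\<^sub>R v)"
    using DERIV_pos_inc_right[of "\<lambda>t. f (q + t *\<^sub>R v)" "D v" 0] by auto
  obtain b where b: "b > 0" "\<And>t. t > 0 \<Longrightarrow> t < b \<Longrightarrow> f (q + t *\<^sub>R v) \<le> f q"
    using assms(2) by (auto simp: eventually_at_right_field)
  define t where "t = min b d / 2"
  have "t > 0" "t < b" "t < d" using b(1) d(1) by (auto simp: t_def)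
  then show False using d(2)[of t] b(2)[of t] by simp
qed

lemma eventually_in_ball_along_ray:
  fixes x q v :: "'a::real_inner"
  assumes "v \<bullet> (x - q) > 0"
  shows "\<forall>\<^sub>F t in at_right 0. q + t *\<^sub>R v \<in> ball x (dist x q)"
proof -
  have "v \<noteq> 0" using assms by auto
  define b where "b = 2 * (v \<bullet> (x - q)) / (v \<bullet> v)"
  have "b > 0" using assms \<open>v \<noteq> 0\<close> by (simp add: b_def)
  have "q + t *\<^sub>R v \<in> ball x (dist x q)" if t: "0 < t" "t < b" for t
  proof -
    have "t * (v \<bullet> v) < 2 * (v \<bullet> (x - q))"
      using t(2) \<open>v \<noteq> 0\<close> by (simp add: b_def field_simps)
    then have "t * (t * (v \<bullet> v)) < t * (2 * (v \<bullet> (x - q)))" using t(1) by (rule mult_strict_left_mono)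
    moreover have "(norm (x - (q + t *\<^sub>R v)))\<^sup>2 =
        (norm (x - q))\<^sup>2 - t * (2 * (v \<bullet> (x - q))) + t * (t * (v \<bullet> v))"
      by (simp add: power2_norm_eq_inner inner_diff_left inner_diff_right inner_add_left
          inner_add_right inner_commute algebra_simps)
    ultimately have "(norm (x - (q + t *\<^sub>R v)))\<^sup>2 < (norm (x - q))\<^sup>2" by linarith
    then show ?thesis by (simp add: dist_norm power2_less_imp_less)
  qed
  then show ?thesis using \<open>b > 0\<close> unfolding eventually_at_right_field by blast
qed

lemma infdist_frontier_ball:
  assumes "dist x q = infdist x (frontier \<Omega>)"
  shows "ball x (dist x q) \<inter> frontier \<Omega> = {}"
  using assms infdist_le[of _ "frontier \<Omega>" x] by (force simp: disjoint_iff)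

lemma boundary_defining_function_zero:
  fixes \<rho> :: "'a::real_normed_vector \<Rightarrow> real"
  assumes "open \<Omega>" "open U" "q \<in> U" "q \<in> frontier \<Omega>" "\<Omega> \<inter> U = {x \<in> U. \<rho> x < 0}"
    and cont: "isCont \<rho> q"
  shows "\<rho> q = 0"
proof (rule ccontr)
  assume nz: "\<rho> q \<noteq> 0"
  have "q \<notin> \<Omega>" using assms(1,4) by (simp add: frontier_def interior_open)
  then have "\<rho> q > 0" using nz assms(3,5) by force
  then have "\<forall>\<^sub>F x in nhds q. \<rho> x > 0"
    using cont order_tendstoD(1)[of \<rho> "\<rho> q" "nhds q" 0] by (simp add: isCont_def tendsto_nhds_iff)
  moreover have "\<forall>\<^sub>F x in nhds q. x \<in> U" using assms(2,3) by (rule eventually_nhds_in_open)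
  ultimately have "\<forall>\<^sub>F x in nhds q. x \<in> U \<and> \<rho> x > 0" by eventually_elim simp
  then obtain T where T: "open T" "q \<in> T" "\<And>x. x \<in> T \<Longrightarrow> x \<in> U \<and> \<rho> x > 0"
    unfolding eventually_nhds by blast
  have "q \<in> closure \<Omega>" using assms(4) by (simp add: frontier_def)
  then obtain y where "y \<in> \<Omega>" "y \<in> T" using T(1,2) by (metis IntE closure_iff_nhds_not_empty disjoint_iff order_refl)
  then show False using T(3)[of y] assms(5) by force
qed

lemma signed_distance_frontier: "q \<in> frontier \<Omega> \<Longrightarrow> signed_distance \<Omega> q = 0"
  by (simp add: signed_distance_def)

text \<open>
  The open ball around \<open>x\<close> through its nearest boundary point \<open>q\<close> misses the boundary, so it lies
  entirely inside or entirely outside of \<open>\<Omega>\<close>, and the defining function \<open>\<rho>\<close> has a fixed sign on it.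
  Therefore the gradient of \<open>\<rho>\<close> at \<open>q\<close> is normal to the ball, and the side on which the ball lies
  determines its direction.
\<close>
lemma nearest_boundary_point_normal:
  fixes \<rho> :: "'a::euclidean_space \<Rightarrow> real"
  assumes "open \<Omega>" "open U" "q \<in> U" "q \<in> frontier \<Omega>" "\<Omega> \<inter> U = {x \<in> U. \<rho> x < 0}"
    and D: "(\<rho> has_derivative (\<lambda>v. w \<bullet> v)) (at q)" and "w \<noteq> 0"
    and near: "dist x q = infdist x (frontier \<Omega>)"
  shows "x - q = (signed_distance \<Omega> x / norm w) *\<^sub>R w"
proof (cases "x = q")
  case True
  then show ?thesis using assms(4) by (simp add: signed_distance_frontier)
next
  case False
  have \<rho>q: "\<rho> q = 0"
    using boundary_defining_function_zero[OF assms(1-5)] has_derivative_continuous[OF D] by simp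
  note disj = infdist_frontier_ball[OF near]
  have x: "x \<in> ball x (dist x q)" using False by simp
  have U: "\<forall>\<^sub>F t in at_right 0. q + t *\<^sub>R v \<in> U" for v
  proof -
    have "((\<lambda>t. q + t *\<^sub>R v) \<longlongrightarrow> q + 0 *\<^sub>R v) (at_right 0)" by (intro tendsto_intros)
    then show ?thesis using topological_tendstoD[OF _ assms(2)] assms(3) by simp
  qed
  show ?thesis
  proof (cases "x \<in> \<Omega>")
    case True
    then have sub: "ball x (dist x q) \<subseteq> \<Omega>"
      using connected_Int_frontier[of "ball x (dist x q)" \<Omega>] disj x by blast
    have "w \<bullet> v \<le> 0" if "v \<bullet> (x - q) > 0" for v
    proof (rule directional_derivative_nonpos[OF D])
      show "\<forall>\<^sub>F t in at_right 0. \<rho> (q + t *\<^sub>R v) \<le> \<rho> q"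
        using eventually_in_ball_along_ray[OF that] U[of v]
        by eventually_elim (use sub assms(5) \<rho>q in force)
    qed
    then have "x - q = - (norm (x - q) / norm w) *\<^sub>R w"
      by (intro antiparallelI) (use False assms(7) in auto)
    then show ?thesis using True near by (simp add: signed_distance_def dist_norm)
  next
    case out: False
    then have sub: "ball x (dist x q) \<inter> \<Omega> = {}"
      using connected_Int_frontier[of "ball x (dist x q)" \<Omega>] disj x by blast
    have "(- w) \<bullet> v \<le> 0" if "v \<bullet> (x - q) > 0" for v
    proof -
      have D': "((\<lambda>x. - \<rho> x) has_derivative (\<lambda>v. - w \<bullet> v)) (at q)"
        using has_derivative_minus[OF D] by simp
      have "\<forall>\<^sub>F t in at_right 0. - \<rho> (q + t *\<^sub>R v) \<le> - \<rho> q"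
        using eventually_in_ball_along_ray[OF that] U[of v]
        by eventually_elim (use sub assms(5) \<rho>q in force)
      from directional_derivative_nonpos[OF D' this] show ?thesis by simp
    qed
    then have "x - q = - (norm (x - q) / norm (- w)) *\<^sub>R (- w)"
      by (intro antiparallelI) (use False assms(7) in auto)
    then show ?thesis using out near by (simp add: signed_distance_def dist_norm)
  qed
qed

section \<open>Smoothness of the signed distance near the boundary\<close>
lemma Ck_on_Pair:
  assumes "open S" "Ck_on k S f" "Ck_on k S g"
  shows "Ck_on k S (\<lambda>x. (f x, g x))"
proof -
  have "Ck_on k S (\<lambda>x. (f x, 0) + (0, g x))"
    by (intro Ck_on_add assms
        Ck_on_bounded_linear[OF _ bounded_linear_Pair[OF bounded_linear_ident bounded_linear_zero]]
        Ck_on_bounded_linear[OF _ bounded_linear_Pair[OF bounded_linear_zero bounded_linear_ident]])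
  then show ?thesis by simp
qed

lemma Ck_on_normalize:
  fixes f :: "'a::real_normed_vector \<Rightarrow> 'b::euclidean_space"
  assumes "open S" "Ck_on k S f" "\<And>x. x \<in> S \<Longrightarrow> f x \<noteq> 0"
  shows "Ck_on k S (\<lambda>x. (1 / norm (f x)) *\<^sub>R f x)"
proof -
  have "Ck_on k S (\<lambda>x. (f x \<bullet> f x) powr (- 1 / 2))"
    by (rule Ck_on_compose[OF assms(1) _ _ Ck_on_powr Ck_on_bilinear[OF assms(1)
        bounded_bilinear_inner assms(2,2)]]) (use assms(3) in auto)
  then have "Ck_on k S (\<lambda>x. (f x \<bullet> f x) powr (- 1 / 2) *\<^sub>R f x)"
    by (rule Ck_on_bilinear[OF assms(1) bounded_bilinear_scaleR _ assms(2)])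
  moreover have "(f x \<bullet> f x) powr (- 1 / 2) = 1 / norm (f x)" for x
    by (simp add: powr_minus_divide powr_half_sqrt norm_eq_sqrt_inner)
  ultimately show ?thesis by simp
qed

text \<open>
  For a local defining function \<open>\<rho>\<close> with gradient \<open>w\<close>, the map \<open>G (y, t) = (y + t w(y), \<rho> y)\<close> is a
  local diffeomorphism at \<open>(p, 0)\<close>: a kernel vector \<open>(v, \<tau>)\<close> of its derivative satisfies
  \<open>v = - \<tau> w(p)\<close> with \<open>v\<close> orthogonal to \<open>w(p)\<close>. The first component \<open>Y x\<close> of the preimage of \<open>(x, 0)\<close>
  satisfies \<open>\<rho> (Y x) = 0\<close>, and \<open>x\<close> lies on the normal through it. Since every nearest boundary point gives such a preimage, local injectivity makes \<open>Y x\<close> the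
  nearest one; it depends smoothly on \<open>x\<close>, and so does the unit normal \<open>n\<close> at \<open>Y x\<close>. Finally
  \<open>\<delta> x = (x - Y x) \<bullet> n x\<close>, and the terms with \<open>Y'\<close> and \<open>n'\<close> drop out of its derivative because \<open>Y'\<close> is
  tangential and \<open>n\<close> has constant length.
\<close>
lemma signed_distance_local_normal_field:
  fixes \<Omega> :: "'a::euclidean_space set"
  assumes "open \<Omega>" "smooth_boundary \<Omega>" "p \<in> frontier \<Omega>"
  obtains r n where "r > 0" "smooth_on (ball p r) n" "\<And>x. x \<in> ball p r \<Longrightarrow> norm (n x) = 1"
    "\<And>x. x \<in> ball p r \<Longrightarrow> (signed_distance \<Omega> has_derivative (\<lambda>v. n x \<bullet> v)) (at x)"
proof -
  obtain U and \<rho> :: "'a \<Rightarrow> real" where U: "open U" "p \<in> U" and \<rho>: "smooth_on U \<rho>"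
    and nz: "\<And>x. x \<in> U \<Longrightarrow> frechet_derivative \<rho> (at x) \<noteq> (\<lambda>_. 0)"
    and \<Omega>U: "\<Omega> \<inter> U = {x \<in> U. \<rho> x < 0}"
    using assms(2,3) unfolding smooth_boundary_def by metis
  define w where "w = gradient \<rho>"
  have \<rho>k: "Ck_on k U \<rho>" for k using \<rho> by (simp add: smooth_on_def)
  have w: "(\<rho> has_derivative (\<lambda>v. w x \<bullet> v)) (at x)" if "x \<in> U" for x
    using \<rho>k[of "Suc 0"] that has_derivative_gradient by (auto simp: w_def)
  have wk: "Ck_on k U w" for k unfolding w_def by (rule Ck_on_gradient[OF U(1) \<rho>k])
  have w0: "w x \<noteq> 0" if "x \<in> U" for x
    using nz[OF that] frechet_derivative_at[OF w[OF that]] by auto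
  define G where "G z = (fst z + snd z *\<^sub>R w (fst z), \<rho> (fst z))" for z
  have open': "open (U \<times> (UNIV :: real set))" using U(1) by (simp add: open_Times)
  have fstk: "Ck_on k (U \<times> (UNIV :: real set)) fst" and sndk: "Ck_on k (U \<times> (UNIV :: real set)) snd" for k
    using Ck_on_bounded_linear[OF open' bounded_linear_fst Ck_on_ident[OF open']]
      Ck_on_bounded_linear[OF open' bounded_linear_snd Ck_on_ident[OF open']] by auto
  have fstU: "fst ` (U \<times> (UNIV :: real set)) \<subseteq> U" by auto
  note comp = Ck_on_compose[OF open' U(1) fstU wk fstk] Ck_on_compose[OF open' U(1) fstU \<rho>k fstk]
  have "Ck_on k (U \<times> UNIV) G" for k
    unfolding G_def[abs_def]
    by (intro Ck_on_Pair Ck_on_add Ck_on_bilinear[OF _ bounded_bilinear_scaleR] open' comp fstk sndk)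
  then have G: "smooth_on (U \<times> UNIV) G" by (simp add: smooth_on_def)
  have p0: "(p, 0) \<in> U \<times> (UNIV :: real set)" using U(2) by simp
  have G': "(G has_derivative (\<lambda>v. (fst v + snd v *\<^sub>R w p, w p \<bullet> fst v))) (at (p, 0))"
  proof -
    have "(w has_derivative frechet_derivative w (at p)) (at p)"
      using Ck_on_SucD(1)[OF wk U(2)] .
    then have 1: "((\<lambda>z. w (fst z)) has_derivative (\<lambda>v. frechet_derivative w (at p) (fst v))) (at (p, 0::real))"
      by (intro has_derivative_compose[OF has_derivative_fst[OF has_derivative_ident], where g = w]) simp
    have 2: "((\<lambda>z. \<rho> (fst z)) has_derivative (\<lambda>v. w p \<bullet> fst v)) (at (p, 0::real))"
      using w[OF U(2)]
    by (intro has_derivative_compose[OF has_derivative_fst[OF has_derivative_ident], where g = \<rho>]) simp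
    show ?thesis unfolding G_def[abs_def]
      by (rule has_derivative_eq_rhs, rule has_derivative_Pair[OF has_derivative_add[OF
          has_derivative_fst[OF has_derivative_ident] has_derivative_scaleR[OF
          has_derivative_snd[OF has_derivative_ident] 1]] 2]) auto
  qed
  have inj: "v = 0" if "frechet_derivative G (at (p, 0)) v = 0" for v
  proof -
    have v: "fst v + snd v *\<^sub>R w p = 0" "w p \<bullet> fst v = 0"
      using that frechet_derivative_at[OF G', symmetric] by (auto simp: zero_prod_def)
    then have "fst v = - (snd v *\<^sub>R w p)" by (simp add: eq_neg_iff_add_eq_0)
    with v(2) w0[OF U(2)] have "snd v = 0" by simp
    with v(1) show "v = 0" by (simp add: prod_eq_iff)
  qed
  from smooth_inverse_function[OF open' p0 G inj]
  obtain U' V g where U': "open U'" "U' \<subseteq> U \<times> UNIV" "(p, 0) \<in> U'" and V: "open V" "G (p, 0) \<in> V"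
    and hom: "homeomorphism U' V G g" and g: "smooth_on V g" by metis
  have Gg: "g (G z) = z" if "z \<in> U'" for z using hom that by (simp add: homeomorphism_def)
  have \<rho>0: "\<rho> q = 0" if "q \<in> frontier \<Omega>" "q \<in> U" for q
    using boundary_defining_function_zero[OF assms(1) U(1) that(2,1) \<Omega>U]
      has_derivative_continuous[OF w[OF that(2)]] by simp
  define V0 where "V0 = {x. (x, 0) \<in> V}"
  have V0: "open V0" "p \<in> V0"
  proof -
    have "V0 = (\<lambda>x. (x, 0)) -` V" by (auto simp: V0_def)
    then show "open V0" using V(1) by (auto intro!: open_vimage continuous_intros)
    show "p \<in> V0" using V(2) \<rho>0[OF assms(3) U(2)] by (simp add: V0_def G_def)
  qed
  define Y where "Y x = fst (g (x, 0))" for x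
  obtain \<eta> where \<eta>: "\<eta> > 0" "ball (p, 0) \<eta> \<subseteq> U'" using U'(1,3) openE by blast
  obtain r1 where r1: "r1 > 0" "ball p r1 \<subseteq> U" using U openE by blast
  have "isCont w p"
    using Ck_on_imp_continuous_on[OF wk] U continuous_on_eq_continuous_at by blast
  then have "isCont (\<lambda>x. norm (w x)) p" by (intro continuous_intros)
  then obtain r2 where r2: "r2 > 0" "\<And>q. dist q p < r2 \<Longrightarrow> norm (w q) > norm (w p) / 2"
    using w0[OF U(2)] unfolding continuous_at_eps_delta
    by (drule_tac x = "norm (w p) / 2" in spec) (force simp: dist_real_def abs_real_def split: if_splits)
  obtain r3 where r3: "r3 > 0" "ball p r3 \<subseteq> V0" using V0 openE by blast
  \<comment> \<open>For \<open>x\<close> in \<open>ball p r\<close> a nearest boundary point \<open>q\<close> lies in \<open>ball p (2 r)\<close>, and the parameter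
    \<open>t\<close> with \<open>x - q = t w(q)\<close> satisfies \<open>\<bar>t\<bar> < r / norm (w q) \<le> \<eta> / 2\<close>; hence \<open>(q, t)\<close> is in the
    domain where \<open>G\<close> is injective.\<close>
  define r where "r = Min {r1 / 2, r2 / 2, r3, \<eta> / 4, \<eta> * norm (w p) / 4}"
  have "r > 0" using r1(1) r2(1) r3(1) \<eta>(1) w0[OF U(2)] by (simp add: r_def)
  have "r \<le> r1 / 2 \<and> r \<le> r2 / 2 \<and> r \<le> r3 \<and> r \<le> \<eta> / 4 \<and> r \<le> \<eta> * norm (w p) / 4"
    unfolding r_def by (intro conjI Min_le finite.intros insertI1 insertI2)
  then have r: "r > 0" "2 * r \<le> r1" "2 * r \<le> r2" "r \<le> r3" "4 * r \<le> \<eta>" "4 * r \<le> \<eta> * norm (w p)"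
    using \<open>r > 0\<close> by linarith+
  define \<delta> where "\<delta> = signed_distance \<Omega>"
  define n where "n x = (1 / norm (w (Y x))) *\<^sub>R w (Y x)" for x
  have foot: "Y x \<in> U \<and> \<rho> (Y x) = 0 \<and> x - Y x = \<delta> x *\<^sub>R n x" if x: "x \<in> ball p r" for x
  proof -
    obtain q where q: "q \<in> frontier \<Omega>" "infdist x (frontier \<Omega>) = dist x q"
      using infdist_attains_inf[of "frontier \<Omega>" x] assms(3) by auto
    have xq: "dist x q < r" using infdist_le[OF assms(3), of x] q(2) x by (simp add: dist_commute)
    have qp: "dist q p < 2 * r"
      using xq x dist_triangle[of q p x] by (simp add: dist_commute)
    then have qU: "q \<in> U" using r1(2) r(2) by (auto simp: dist_commute subset_iff)
    define t where "t = \<delta> x / norm (w q)"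
    have eq: "x - q = t *\<^sub>R w q"
      using nearest_boundary_point_normal[OF assms(1) U(1) qU q(1) \<Omega>U w[OF qU] w0[OF qU] q(2)[symmetric]]
      by (simp add: t_def \<delta>_def)
    have "norm (w q) > norm (w p) / 2" using r2(2)[of q] qp r(3) by simp
    have "\<bar>t\<bar> * norm (w q) < r" using xq eq by (simp add: dist_norm)
    then have "\<bar>t\<bar> * norm (w q) < \<eta> / 2 * (norm (w p) / 2)" using r(6) by simp
    also have "\<dots> \<le> \<eta> / 2 * norm (w q)"
      using \<open>norm (w q) > norm (w p) / 2\<close> \<eta>(1) by (intro mult_left_mono) auto
    finally have "\<bar>t\<bar> < \<eta> / 2" by (rule mult_right_less_imp_less) simp
    then have "dist (q, t) (p, 0) < \<eta>"
      using qp r(5) sqrt_sum_squares_le_sum_abs[of "dist q p" "dist t 0"]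
      by (simp add: dist_Pair_Pair)
    then have "(q, t) \<in> U'" using \<eta>(2) by (auto simp: dist_commute subset_iff)
    then have "g (G (q, t)) = (q, t)" by (rule Gg)
    moreover have "G (q, t) = (x, 0)"
      using eq \<rho>0[OF q(1) qU] by (simp add: G_def algebra_simps)
    ultimately have "Y x = q" by (simp add: Y_def)
    then show ?thesis using qU \<rho>0[OF q(1) qU] eq by (simp add: n_def t_def)
  qed
  have Yk: "Ck_on k (ball p r) Y" for k
  proof -
    have "Ck_on k (ball p r) (\<lambda>x. g (x, 0))"
      by (rule Ck_on_compose[OF open_ball V(1), of "\<lambda>x. (x, 0)"])
         (use r3(2) r(4) g in \<open>auto simp: V0_def smooth_on_def subset_iff intro!: Ck_on_Pair Ck_on_ident Ck_on_const\<close>)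
    then show ?thesis
      unfolding Y_def[abs_def] by (rule Ck_on_bounded_linear[OF open_ball bounded_linear_fst])
  qed
  have YU: "Y ` ball p r \<subseteq> U" using foot by auto
  have nk: "Ck_on k (ball p r) n" for k
    unfolding n_def[abs_def]
    by (rule Ck_on_normalize[OF open_ball Ck_on_compose[OF open_ball U(1) YU wk Yk]])
       (use foot w0 in auto)
  have n1: "norm (n x) = 1" if "x \<in> ball p r" for x
    using foot[OF that] w0 by (simp add: n_def)
  show thesis
  proof (rule that[OF r(1) _ n1])
    show "smooth_on (ball p r) n" using nk by (simp add: smooth_on_def)
  next
    fix x assume x: "x \<in> ball p r"
    define n' where "n' = frechet_derivative n (at x)"
    define Y' where "Y' = frechet_derivative Y (at x)"
    have dn: "(n has_derivative n') (at x)" and dY: "(Y has_derivative Y') (at x)"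
      using Ck_on_SucD(1)[OF nk x] Ck_on_SucD(1)[OF Yk x] by (auto simp: n'_def Y'_def)
    have nn': "n x \<bullet> n' v = 0" for v
    proof -
      have "((\<lambda>x. n x \<bullet> n x) has_derivative (\<lambda>v. n x \<bullet> n' v + n' v \<bullet> n x)) (at x)"
        by (rule has_derivative_inner[OF dn dn])
      moreover have "((\<lambda>x. n x \<bullet> n x) has_derivative (\<lambda>v. 0)) (at x)"
        by (rule has_derivative_transform_within_open[OF has_derivative_const[of 1] open_ball x])
           (use n1 in \<open>simp add: norm_eq_1\<close>)
      ultimately have "(\<lambda>v. n x \<bullet> n' v + n' v \<bullet> n x) = (\<lambda>v. 0)" by (rule has_derivative_unique)
      from fun_cong[OF this, of v] show ?thesis by (simp add: inner_commute)
    qed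
    have nY': "n x \<bullet> Y' v = 0" for v
    proof -
      have "((\<lambda>x. \<rho> (Y x)) has_derivative (\<lambda>v. w (Y x) \<bullet> Y' v)) (at x)"
        using has_derivative_compose[OF dY w] foot[OF x] by simp
      moreover have "((\<lambda>x. \<rho> (Y x)) has_derivative (\<lambda>v. 0)) (at x)"
        by (rule has_derivative_transform_within_open[OF has_derivative_const[of 0] open_ball x])
           (use foot in simp)
      ultimately have "(\<lambda>v. w (Y x) \<bullet> Y' v) = (\<lambda>v. 0)" by (rule has_derivative_unique)
      from fun_cong[OF this, of v] show ?thesis by (simp add: n_def)
    qed
    have "((\<lambda>x. (x - Y x) \<bullet> n x) has_derivative (\<lambda>v. (x - Y x) \<bullet> n' v + (v - Y' v) \<bullet> n x)) (at x)"
      by (rule has_derivative_inner[OF has_derivative_diff[OF has_derivative_ident dY] dn])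
    moreover have "(x - Y x) \<bullet> n' v + (v - Y' v) \<bullet> n x = n x \<bullet> v" for v
      using foot[OF x] nn' nY'[of v] by (simp add: inner_diff_left inner_diff_right inner_commute)
    ultimately have "((\<lambda>x. (x - Y x) \<bullet> n x) has_derivative (\<lambda>v. n x \<bullet> v)) (at x)" by simp
    then show "(signed_distance \<Omega> has_derivative (\<lambda>v. n x \<bullet> v)) (at x)"
      by (rule has_derivative_transform_within_open[OF _ open_ball x])
         (use foot n1 in \<open>simp add: norm_eq_1 \<delta>_def\<close>)
  qed
qed

lemma signed_distance_tubular_neighborhood:
  fixes \<Omega> :: "'a::euclidean_space set"
  assumes "open \<Omega>" "smooth_boundary \<Omega>"
  obtains W where "open W" "frontier \<Omega> \<subseteq> W" "smooth_on W (gradient (signed_distance \<Omega>))"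
    "\<And>x. x \<in> W \<Longrightarrow> signed_distance \<Omega> differentiable (at x)"
    "\<And>x. x \<in> W \<Longrightarrow> norm (gradient (signed_distance \<Omega>) x) = 1"
proof -
  define \<delta> where "\<delta> = signed_distance \<Omega>"
  have "\<exists>r>0. smooth_on (ball p r) (gradient \<delta>) \<and>
      (\<forall>x\<in>ball p r. \<delta> differentiable (at x) \<and> norm (gradient \<delta> x) = 1)"
    if p: "p \<in> frontier \<Omega>" for p
  proof -
    obtain r n where r: "r > 0" "smooth_on (ball p r) n" "\<And>x. x \<in> ball p r \<Longrightarrow> norm (n x) = 1"
      "\<And>x. x \<in> ball p r \<Longrightarrow> (\<delta> has_derivative (\<lambda>v. n x \<bullet> v)) (at x)"
      by (rule signed_distance_local_normal_field[OF assms p, folded \<delta>_def]) (rule that; assumption)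
    have eq: "n x = gradient \<delta> x" if "x \<in> ball p r" for x
      using gradient_unique[OF r(4)[OF that]] by simp
    have "Ck_on k (ball p r) (gradient \<delta>)" for k
      by (rule Ck_on_cong_open[OF open_ball eq]) (use r(2) in \<open>simp_all add: smooth_on_def\<close>)
    then have "smooth_on (ball p r) (gradient \<delta>)" by (simp add: smooth_on_def)
    then show ?thesis using r eq differentiableI by (metis (lifting))
  qed
  then obtain R where R: "\<And>p. p \<in> frontier \<Omega> \<Longrightarrow> R p > 0 \<and> smooth_on (ball p (R p)) (gradient \<delta>) \<and>
      (\<forall>x\<in>ball p (R p). \<delta> differentiable (at x) \<and> norm (gradient \<delta> x) = 1)"
    by metis
  define W where "W = (\<Union>p\<in>frontier \<Omega>. ball p (R p))"
  show thesis
  proof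
    show "open W" by (auto simp: W_def)
    show "frontier \<Omega> \<subseteq> W" using R by (force simp: W_def)
    have "Ck_on k W (gradient \<delta>)" for k
      by (rule Ck_on_local) (use R in \<open>force simp: W_def smooth_on_def\<close>)
    then show "smooth_on W (gradient (signed_distance \<Omega>))" by (simp add: smooth_on_def \<delta>_def)
  qed (use R in \<open>auto simp: W_def \<delta>_def\<close>)
qed

section \<open>Normal segments\<close>
text \<open>
  By the triangle inequality, \<open>p\<close> is a nearest boundary point for every point of the segment, so the
  signed distance decreases at unit rate from \<open>p\<close> to \<open>x\<close>. A gradient of length one with directional
  derivative one in a unit direction equals that direction.
\<close>
lemma segment_to_nearest_boundary_point:
  fixes \<Omega> :: "'a::euclidean_space set"
  assumes p: "p \<in> frontier \<Omega>" and x: "x \<in> \<Omega>" "dist x p = s" "infdist x (frontier \<Omega>) = s" "0 < s"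
    and diff: "\<And>y. y \<in> closed_segment x p \<Longrightarrow> signed_distance \<Omega> differentiable (at y)"
    and unit: "\<And>y. y \<in> closed_segment x p \<Longrightarrow> norm (gradient (signed_distance \<Omega>) y) = 1"
  defines "n \<equiv> gradient (signed_distance \<Omega>)"
  shows "x = p - s *\<^sub>R n p"
    and "\<And>\<tau>. \<tau> \<in> {0..s} \<Longrightarrow> n (p - \<tau> *\<^sub>R n p) = n p"
    and "\<And>\<tau>. \<tau> \<in> {0..s} \<Longrightarrow> infdist (p - \<tau> *\<^sub>R n p) (frontier \<Omega>) = \<tau>"
proof -
  define e where "e = (1 / s) *\<^sub>R (p - x)"
  have e1: "norm e = 1" using x(2,4) by (simp add: e_def dist_norm norm_minus_commute)
  have xe: "x = p - s *\<^sub>R e" using x(4) by (simp add: e_def)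
  have seg: "p - \<tau> *\<^sub>R e \<in> closed_segment x p" if "\<tau> \<in> {0..s}" for \<tau>
    unfolding in_segment
    by (rule exI[of _ "1 - \<tau> / s"]) (use that x(4) in \<open>simp add: xe algebra_simps\<close>)
  have dx: "dist x (p - \<tau> *\<^sub>R e) = s - \<tau>" if "\<tau> \<in> {0..s}" for \<tau>
  proof -
    have "x - (p - \<tau> *\<^sub>R e) = (\<tau> - s) *\<^sub>R e" by (simp add: xe algebra_simps)
    then have "dist x (p - \<tau> *\<^sub>R e) = \<bar>\<tau> - s\<bar> * norm e" by (simp add: dist_norm)
    then show ?thesis using that e1 by simp
  qed
  have inf: "infdist (p - \<tau> *\<^sub>R e) (frontier \<Omega>) = \<tau>" if "\<tau> \<in> {0..s}" for \<tau>
  proof (rule antisym)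
    show "infdist (p - \<tau> *\<^sub>R e) (frontier \<Omega>) \<le> \<tau>"
      using infdist_le[OF p, of "p - \<tau> *\<^sub>R e"] that e1 by (simp add: dist_norm)
    show "\<tau> \<le> infdist (p - \<tau> *\<^sub>R e) (frontier \<Omega>)"
      using infdist_triangle[of x "frontier \<Omega>" "p - \<tau> *\<^sub>R e"] dx[OF that] x(3) by simp
  qed
  have ball: "ball x s \<subseteq> \<Omega>"
  proof -
    have "x \<in> ball x s" using x(4) by simp
    moreover have "ball x s \<inter> frontier \<Omega> = {}" using infdist_frontier_ball[of x p \<Omega>] x by simp
    ultimately show ?thesis using connected_Int_frontier[of "ball x s" \<Omega>] x(1) by blast
  qed
  have sd: "signed_distance \<Omega> (p - \<tau> *\<^sub>R e) = - \<tau>" if "\<tau> \<in> {0..s}" for \<tau>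
  proof (cases "\<tau> = 0")
    case True
    then show ?thesis using p by (simp add: signed_distance_frontier)
  next
    case False
    then have "p - \<tau> *\<^sub>R e \<in> \<Omega>" using dx[OF that] that ball by (auto simp: subset_iff)
    then show ?thesis using inf[OF that] by (simp add: signed_distance_def)
  qed
  have ne: "n (p - \<tau> *\<^sub>R e) = e" if t: "\<tau> \<in> {0..s}" for \<tau>
  proof -
    let ?y = "p - \<tau> *\<^sub>R e"
    have "((\<lambda>\<tau>. signed_distance \<Omega> (p + \<tau> *\<^sub>R (- e))) has_vector_derivative n ?y \<bullet> (- e)) (at \<tau> within {0..s})"
      unfolding n_def
      by (rule has_vector_derivative_along_line) (use has_derivative_gradient[OF diff[OF seg[OF t]]] in simp)
    then have 1: "((\<lambda>\<tau>. - \<tau>) has_vector_derivative n ?y \<bullet> (- e)) (at \<tau> within {0..s})"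
      by (rule has_vector_derivative_transform[OF t, rotated]) (use sd in simp)
    have 2: "((\<lambda>\<tau>. - \<tau>) has_vector_derivative - 1) (at \<tau> within {0..s})"
      by (auto intro!: derivative_eq_intros)
    have "n ?y \<bullet> (- e) = - 1"
      using vector_derivative_unique_within[OF _ 1 2] t x(4) by (simp add: at_within_Icc_at trivial_limit_within islimpt_Icc)
    then have "(norm (n ?y - e))\<^sup>2 = 0"
      using unit[OF seg[OF t]] e1
      by (simp add: n_def power2_norm_eq_inner inner_diff_left inner_diff_right inner_commute norm_eq_1)
    then show ?thesis by simp
  qed
  have np: "n p = e" using ne[of 0] x(4) by simp
  show "x = p - s *\<^sub>R n p" using xe np by simp
  show "n (p - \<tau> *\<^sub>R n p) = n p" "infdist (p - \<tau> *\<^sub>R n p) (frontier \<Omega>) = \<tau>" if "\<tau> \<in> {0..s}" for \<tau>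
    using ne[OF that] inf[OF that] np by simp_all
qed

section \<open>Functions with gradient of length one\<close>
locale unit_gradient =
  fixes \<delta> :: "'a::euclidean_space \<Rightarrow> real" and W :: "'a set"
  assumes open_W: "open W"
    and differentiable: "x \<in> W \<Longrightarrow> \<delta> differentiable (at x)"
    and smooth_gradient: "smooth_on W (gradient \<delta>)"
    and norm_gradient: "x \<in> W \<Longrightarrow> norm (gradient \<delta> x) = 1"
begin

abbreviation n :: "'a \<Rightarrow> 'a" where "n \<equiv> gradient \<delta>"

text \<open>
  The Hessian of \<open>\<delta>\<close> as an endomorphism of the tangent space.
\<close>
definition H :: "'a \<Rightarrow> 'a \<Rightarrow> 'a" where "H x = frechet_derivative n (at x)"

lemma Ck_on_n: "Ck_on k W n"
  using smooth_gradient by (simp add: smooth_on_def)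

lemma Ck_on_H: "Ck_on k W (\<lambda>x. H x v)"
  using Ck_on_SucD(2)[OF Ck_on_n] by (simp add: H_def)

lemma has_derivative_n: "x \<in> W \<Longrightarrow> (n has_derivative H x) (at x)"
  using Ck_on_SucD(1)[OF Ck_on_n] by (simp add: H_def)

lemma linear_H: "x \<in> W \<Longrightarrow> linear (H x)"
  using has_derivative_n has_derivative_linear by blast

lemma has_derivative_H: "x \<in> W \<Longrightarrow> ((\<lambda>y. H y v) has_derivative frechet_derivative (\<lambda>y. H y v) (at x)) (at x)"
  using Ck_on_SucD(1)[OF Ck_on_H] by blast

lemma H_symmetric:
  assumes x: "x \<in> W"
  shows "H x u \<bullet> v = H x v \<bullet> u"
proof -
  have \<delta>': "(\<delta> has_derivative (\<lambda>v. n y \<bullet> v)) (at y)" if "y \<in> W" for y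
    by (rule has_derivative_gradient[OF differentiable[OF that]])
  have "Ck_on (Suc k) W \<delta>" for k
    by (rule Ck_on_SucI[OF open_W \<delta>'])
       (auto intro: Ck_on_bounded_linear[OF open_W bounded_linear_inner_left] Ck_on_n)
  then have sym: "frechet_derivative (\<lambda>y. frechet_derivative \<delta> (at y) v) (at x) u =
      frechet_derivative (\<lambda>y. frechet_derivative \<delta> (at y) u) (at x) v"
    by (rule second_derivative_symmetric[OF open_W x])
  have eq: "frechet_derivative (\<lambda>y. frechet_derivative \<delta> (at y) w) (at x) = (\<lambda>h. H x h \<bullet> w)" for w
  proof (rule frechet_derivative_at[symmetric])
    show "((\<lambda>y. frechet_derivative \<delta> (at y) w) has_derivative (\<lambda>h. H x h \<bullet> w)) (at x)"
    proof (rule has_derivative_transform_within_open[OF has_derivative_inner_left[OF has_derivative_n[OF x]] open_W x])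
      show "n y \<bullet> w = frechet_derivative \<delta> (at y) w" if "y \<in> W" for y
        using frechet_derivative_at[OF \<delta>'[OF that]] by metis
    qed
  qed
  show ?thesis using sym by (simp add: eq)
qed

lemma n_inner_H: "x \<in> W \<Longrightarrow> n x \<bullet> H x v = 0"
proof -
  assume x: "x \<in> W"
  have 1: "((\<lambda>y. n y \<bullet> n y) has_derivative (\<lambda>v. n x \<bullet> H x v + H x v \<bullet> n x)) (at x)"
    by (rule has_derivative_inner[OF has_derivative_n[OF x] has_derivative_n[OF x]])
  have 2: "((\<lambda>y. n y \<bullet> n y) has_derivative (\<lambda>v. 0)) (at x)"
    by (rule has_derivative_transform_within_open[OF has_derivative_const[of 1] open_W x])
       (use norm_gradient in \<open>simp add: norm_eq_1\<close>)
  from fun_cong[OF has_derivative_unique[OF 1 2], of v] show ?thesis by (simp add: inner_commute)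
qed

lemma H_n: "x \<in> W \<Longrightarrow> H x (n x) = 0"
  using H_symmetric n_inner_H by (metis inner_commute inner_eq_zero_iff)

text \<open>
  Symmetry of the second derivative, applied to each component of the gradient.
\<close>
lemma third_derivative_symmetric:
  assumes x: "x \<in> W"
  shows "frechet_derivative (\<lambda>y. H y u) (at x) v = frechet_derivative (\<lambda>y. H y v) (at x) u"
proof -
  have "frechet_derivative (\<lambda>y. H y u) (at x) v \<bullet> w = frechet_derivative (\<lambda>y. H y v) (at x) u \<bullet> w" for w
  proof -
    define f where "f y = n y \<bullet> w" for y
    have "Ck_on (Suc (Suc 0)) W f"
      unfolding f_def by (rule Ck_on_bounded_linear[OF open_W bounded_linear_inner_left Ck_on_n])
    then have sym: "frechet_derivative (\<lambda>y. frechet_derivative f (at y) u) (at x) v =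
        frechet_derivative (\<lambda>y. frechet_derivative f (at y) v) (at x) u"
      by (rule second_derivative_symmetric[OF open_W x])
    have f': "(f has_derivative (\<lambda>h. H y h \<bullet> w)) (at y)" if "y \<in> W" for y
      unfolding f_def by (rule has_derivative_inner_left[OF has_derivative_n[OF that]])
    have eq: "frechet_derivative (\<lambda>y. frechet_derivative f (at y) z) (at x) =
        (\<lambda>h. frechet_derivative (\<lambda>y. H y z) (at x) h \<bullet> w)" for z
    proof (rule frechet_derivative_at[symmetric])
      show "((\<lambda>y. frechet_derivative f (at y) z) has_derivative
          (\<lambda>h. frechet_derivative (\<lambda>y. H y z) (at x) h \<bullet> w)) (at x)"
      proof (rule has_derivative_transform_within_open[OF has_derivative_inner_left[OF has_derivative_H[OF x]] open_W x])
        show "H y z \<bullet> w = frechet_derivative f (at y) z" if "y \<in> W" for y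
          using frechet_derivative_at[OF f'[OF that]] by metis
      qed
    qed
    show ?thesis using sym by (simp add: eq)
  qed
  then show ?thesis by (metis vector_eq_rdot)
qed

text \<open>
  Write \<open>T(a; b, c)\<close> for the derivative in direction \<open>a\<close> of \<open>H b \<bullet> c\<close> with \<open>b\<close>, \<open>c\<close> fixed; it is
  symmetric in all three arguments. Differentiating the identity \<open>H u \<bullet> n = 0\<close> in direction \<open>v\<close> gives
  \<open>T(v; u, n) = - H u \<bullet> H v\<close>, and the left side equals \<open>T(n; v, u)\<close>.
\<close>
lemma H_riccati:
  assumes x: "x \<in> W"
  shows "frechet_derivative (\<lambda>y. H y v) (at x) (n x) = - H x (H x v)"
proof -
  have "frechet_derivative (\<lambda>y. H y v) (at x) (n x) \<bullet> u = - H x (H x v) \<bullet> u" for u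
  proof -
    have a1: "((\<lambda>y. H y (n x) \<bullet> u) has_derivative (\<lambda>h. frechet_derivative (\<lambda>y. H y (n x)) (at x) h \<bullet> u)) (at x)"
      by (rule has_derivative_inner_left[OF has_derivative_H[OF x]])
    have a2: "((\<lambda>y. H y u \<bullet> n x) has_derivative (\<lambda>h. frechet_derivative (\<lambda>y. H y u) (at x) h \<bullet> n x)) (at x)"
      by (rule has_derivative_inner_left[OF has_derivative_H[OF x]])
    have a3: "((\<lambda>y. H y (n x) \<bullet> u) has_derivative (\<lambda>h. frechet_derivative (\<lambda>y. H y u) (at x) h \<bullet> n x)) (at x)"
      by (rule has_derivative_transform_within_open[OF a2 open_W x]) (rule H_symmetric)
    have b1: "((\<lambda>y. H y u \<bullet> n y) has_derivative
        (\<lambda>h. H x u \<bullet> H x h + frechet_derivative (\<lambda>y. H y u) (at x) h \<bullet> n x)) (at x)"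
      by (rule has_derivative_inner[OF has_derivative_H[OF x] has_derivative_n[OF x]])
    have b2: "((\<lambda>y. H y u \<bullet> n y) has_derivative (\<lambda>h. 0)) (at x)"
      by (rule has_derivative_transform_within_open[OF has_derivative_const[of 0] open_W x])
         (use n_inner_H in \<open>simp add: inner_commute\<close>)
    have "frechet_derivative (\<lambda>y. H y v) (at x) (n x) \<bullet> u = frechet_derivative (\<lambda>y. H y (n x)) (at x) v \<bullet> u"
      by (simp add: third_derivative_symmetric[OF x])
    also have "\<dots> = frechet_derivative (\<lambda>y. H y u) (at x) v \<bullet> n x"
      using fun_cong[OF has_derivative_unique[OF a1 a3], of v] .
    also have "\<dots> = - (H x u \<bullet> H x v)"
      using fun_cong[OF has_derivative_unique[OF b1 b2], of v] by simp
    also have "\<dots> = - H x (H x v) \<bullet> u" using H_symmetric[OF x, of u "H x v"] by simp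
    finally show ?thesis .
  qed
  then show ?thesis by (metis vector_eq_rdot)
qed

text \<open>
  The product rule for the pairing of the operator \<open>H y\<close> with the vector \<open>u y\<close>, which needs \<open>H\<close> to be
  differentiable as an operator-valued map.
\<close>
lemma has_derivative_H_field:
  assumes x: "x \<in> W" and u: "(u has_derivative u') (at x)"
  shows "((\<lambda>y. H y (u y)) has_derivative
    (\<lambda>h. frechet_derivative (\<lambda>y. H y (u x)) (at x) h + H x (u' h))) (at x)"
proof -
  obtain B where B: "\<And>y. y \<in> W \<Longrightarrow> (n has_derivative blinfun_apply (B y)) (at y)" "Ck_on (Suc 0) W B"
    using Ck_on_blinfun_derivative[OF open_W Ck_on_n] by metis
  have HB: "H y = blinfun_apply (B y)" if "y \<in> W" for y
    using has_derivative_unique[OF has_derivative_n[OF that] B(1)[OF that]] .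
  define B' where "B' = frechet_derivative B (at x)"
  have dB: "(B has_derivative B') (at x)"
    using Ck_on_SucD(1)[OF B(2) x] by (simp add: B'_def)
  have fixed: "((\<lambda>y. H y v) has_derivative (\<lambda>h. blinfun_apply (B' h) v)) (at x)" for v
  proof (rule has_derivative_transform_within_open[OF _ open_W x])
    show "((\<lambda>y. blinfun_apply (B y) v) has_derivative (\<lambda>h. blinfun_apply (B' h) v)) (at x)"
      using bounded_bilinear.FDERIV[OF bounded_bilinear_blinfun_apply dB has_derivative_const] by simp
  qed (simp add: HB)
  have "((\<lambda>y. H y (u y)) has_derivative (\<lambda>h. blinfun_apply (B x) (u' h) + blinfun_apply (B' h) (u x))) (at x)"
    by (rule has_derivative_transform_within_open[OF bounded_bilinear.FDERIV[OF
        bounded_bilinear_blinfun_apply dB u] open_W x]) (simp add: HB)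
  then show ?thesis
    using frechet_derivative_at[OF fixed, symmetric] by (simp add: HB[OF x] add.commute)
qed

lemma has_derivative_H_quadratic:
  assumes x: "x \<in> W" and u: "(u has_derivative u') (at x)"
  obtains D where "((\<lambda>y. H y (u y) \<bullet> u y) has_derivative D) (at x)"
    "D (n x) = 2 * (H x (u x) \<bullet> u' (n x)) - (norm (H x (u x)))\<^sup>2"
proof
  show "((\<lambda>y. H y (u y) \<bullet> u y) has_derivative (\<lambda>h. H x (u x) \<bullet> u' h +
      (frechet_derivative (\<lambda>y. H y (u x)) (at x) h + H x (u' h)) \<bullet> u x)) (at x)"
    by (rule has_derivative_inner[OF has_derivative_H_field[OF assms] u])
  show "H x (u x) \<bullet> u' (n x) + (frechet_derivative (\<lambda>y. H y (u x)) (at x) (n x) + H x (u' (n x))) \<bullet> u x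
    = 2 * (H x (u x) \<bullet> u' (n x)) - (norm (H x (u x)))\<^sup>2"
    using H_symmetric[OF x, of "u' (n x)" "u x"] H_symmetric[OF x, of "H x (u x)" "u x"]
    by (simp add: H_riccati[OF x] inner_add_left inner_diff_left power2_norm_eq_inner)
qed

end

section \<open>Complex coordinates\<close>
definition J :: "complex ^ 'n \<Rightarrow> complex ^ 'n" where
  "J u = (\<chi> i. \<i> * u $ i)"

lemma J_nth [simp]: "J u $ i = \<i> * u $ i"
  by (simp add: J_def)

lemma linear_J: "linear J"
  by (rule linearI) (auto simp: vec_eq_iff algebra_simps)

lemma J_J [simp]: "J (J u) = - u"
  by (simp add: vec_eq_iff)

lemma bounded_linear_J: "bounded_linear (J :: complex ^ 'n::finite \<Rightarrow> complex ^ 'n)"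
  using linear_J by (simp add: linear_conv_bounded_linear)

lemma J_inner: "J u \<bullet> v = - (u \<bullet> J v)" for u v :: "complex ^ 'n::finite"
  by (simp add: inner_vec_def inner_complex_def sum_negf[symmetric])

text \<open>
  The standard Hermitian product of $\mathbb{C}^n$ in terms of the real inner product.
\<close>
lemma sum_mult_cnj: "(\<Sum>i\<in>UNIV. a $ i * cnj (b $ i)) = Complex (a \<bullet> b) (a \<bullet> J b)"
  for a b :: "complex ^ 'n::finite"
  by (rule complex_eqI) (simp_all add: inner_vec_def inner_complex_def algebra_simps)

lemma real_linear_axis_expansion:
  fixes D :: "complex ^ 'n::finite \<Rightarrow> complex"
  assumes "linear D"
  shows "D u = (\<Sum>i\<in>UNIV. of_real (Re (u $ i)) * D (axis i 1) + of_real (Im (u $ i)) * D (axis i \<i>))"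
proof -
  have "u = (\<Sum>i\<in>UNIV. Re (u $ i) *\<^sub>R axis i 1 + Im (u $ i) *\<^sub>R axis i \<i>)"
    (is "_ = (\<Sum>i\<in>UNIV. ?f i)")
  proof -
    have "(\<Sum>i\<in>UNIV. ?f i $ j) = (\<Sum>i\<in>UNIV. if j = i then u $ j else 0)" for j
      by (intro sum.cong refl) (simp add: axis_def complex_eq_iff)
    then show ?thesis by (simp add: vec_eq_iff)
  qed
  then have "D u = D (\<Sum>i\<in>UNIV. Re (u $ i) *\<^sub>R axis i 1 + Im (u $ i) *\<^sub>R axis i \<i>)" by simp
  also have "\<dots> = (\<Sum>i\<in>UNIV. Re (u $ i) *\<^sub>R D (axis i 1) + Im (u $ i) *\<^sub>R D (axis i \<i>))"
    by (simp only: linear_sum[OF assms] linear_add[OF assms] linear_scale[OF assms])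
  finally show ?thesis by (simp add: scaleR_conv_of_real[where 'a = complex])
qed

text \<open>
  A vector of type \<open>(1,0)\<close> with coefficients \<open>u\<close> is the complexified vector \<open>(u - \<i> J u) / 2\<close>.
\<close>
lemma deriv_along_type10:
  assumes f: "(f has_derivative D) (at p)" and "type10 v"
  shows "deriv_along v f p = (D (fst v) - \<i> * D (J (fst v))) / 2"
proof -
  have eq: "frechet_derivative f (at p) = D" using frechet_derivative_at[OF f] by simp
  note lin = has_derivative_linear[OF f]
  have "D (fst v) - \<i> * D (J (fst v)) =
    (\<Sum>i\<in>UNIV. fst v $ i * (D (axis i 1) - \<i> * D (axis i \<i>)))"
    unfolding real_linear_axis_expansion[OF lin, of "fst v"] real_linear_axis_expansion[OF lin, of "J (fst v)"]
      sum_distrib_left sum_subtractf[symmetric]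
  proof (rule sum.cong[OF refl])
    fix i
    show "complex_of_real (Re (fst v $ i)) * D (axis i 1) + complex_of_real (Im (fst v $ i)) * D (axis i \<i>) -
      \<i> * (complex_of_real (Re (J (fst v) $ i)) * D (axis i 1) + complex_of_real (Im (J (fst v) $ i)) * D (axis i \<i>)) =
      fst v $ i * (D (axis i 1) - \<i> * D (axis i \<i>))"
      by (rule complex_eqI) (simp_all add: algebra_simps)
  qed
  then show ?thesis
    using assms(2) by (simp add: deriv_along_def type10_def dz_def eq sum_divide_distrib)
qed

lemma deriv_along_add_conj:
  assumes f: "(f has_derivative D) (at p)" and "type10 v"
  shows "deriv_along (v + conj_tangent v) f p = D (fst v)"
proof -
  have eq: "frechet_derivative f (at p) = D" using frechet_derivative_at[OF f] by simp
  note lin = has_derivative_linear[OF f]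
  have "deriv_along (v + conj_tangent v) f p =
     (\<Sum>i\<in>UNIV. fst v $ i * dz i f p + cnj (fst v $ i) * dzbar i f p)"
    using assms(2) by (simp add: deriv_along_def type10_def conj_tangent_def vec_eq_iff zero_vec_def)
  also have "\<dots> = D (fst v)"
    unfolding real_linear_axis_expansion[OF lin, of "fst v"] dz_def dzbar_def eq
  proof (rule sum.cong[OF refl])
    fix i
    show "fst v $ i * ((D (axis i 1) - \<i> * D (axis i \<i>)) / 2) + cnj (fst v $ i) * ((D (axis i 1) + \<i> * D (axis i \<i>)) / 2) =
      complex_of_real (Re (fst v $ i)) * D (axis i 1) + complex_of_real (Im (fst v $ i)) * D (axis i \<i>)"
      by (rule complex_eqI) (simp_all add: field_simps)
  qed
  finally show ?thesis .
qed

lemma deriv_along_real_zero_iff: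
  fixes \<delta> :: "complex ^ 'n::finite \<Rightarrow> real"
  assumes "\<delta> differentiable (at p)" "type10 v"
  shows "deriv_along v (\<lambda>q. of_real (\<delta> q)) p = 0 \<longleftrightarrow>
    gradient \<delta> p \<bullet> fst v = 0 \<and> gradient \<delta> p \<bullet> J (fst v) = 0"
proof -
  have "((\<lambda>q. of_real (\<delta> q) :: complex) has_derivative (\<lambda>v. of_real (gradient \<delta> p \<bullet> v))) (at p)"
    by (rule has_derivative_of_real[OF has_derivative_gradient[OF assms(1)]])
  then show ?thesis by (auto simp: deriv_along_type10[OF _ assms(2)] complex_eq_iff)
qed

lemma dzbar_real:
  fixes \<delta> :: "complex ^ 'n::finite \<Rightarrow> real"
  assumes "\<delta> differentiable (at p)"
  shows "dzbar i (\<lambda>q. of_real (\<delta> q)) p = gradient \<delta> p $ i / 2"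
proof -
  have "((\<lambda>q. of_real (\<delta> q) :: complex) has_derivative (\<lambda>v. of_real (gradient \<delta> p \<bullet> v))) (at p)"
    by (rule has_derivative_of_real[OF has_derivative_gradient[OF assms]])
  from frechet_derivative_at[OF this, symmetric] show ?thesis
    by (simp add: dzbar_def inner_axis inner_complex_def complex_eq_iff)
qed

lemma has_derivative_nth:
  fixes f :: "'a::real_normed_vector \<Rightarrow> complex ^ 'n::finite"
  shows "(f has_derivative f') F \<Longrightarrow> ((\<lambda>x. f x $ i) has_derivative (\<lambda>h. f' h $ i)) F"
  by (rule bounded_linear.has_derivative[OF bounded_linear_vec_nth])

locale complex_unit_gradient = unit_gradient \<delta> W
  for \<delta> :: "complex ^ 'n::finite \<Rightarrow> real" and W
begin

text \<open>
  Four times the complex Hessian of \<open>\<delta>\<close> at \<open>x\<close>, evaluated at the vector of type \<open>(1,0)\<close> with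
  coefficients \<open>u\<close>; see \<open>complex_hess_eq\<close>.
\<close>
definition Q :: "complex ^ 'n \<Rightarrow> complex ^ 'n \<Rightarrow> real" where
  "Q x u = H x u \<bullet> u + H x (J u) \<bullet> J u"

lemma normalized_cgrad:
  assumes x: "x \<in> W"
  shows "normalized_cgrad \<delta> x = (sqrt 2 *\<^sub>R n x, 0)"
proof -
  have c: "cgrad \<delta> x = ((1 / 2) *\<^sub>R n x, 0)"
    by (simp add: cgrad_def dzbar_real[OF differentiable[OF x]] vec_eq_iff scaleR_conv_of_real[where 'a = complex])
  have "herm (cgrad \<delta> x) (cgrad \<delta> x) = of_real (1 / 8)"
  proof -
    have "herm (cgrad \<delta> x) (cgrad \<delta> x) = (\<Sum>i\<in>UNIV. n x $ i * cnj (n x $ i)) / 8"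
      unfolding herm_def c sum_divide_distrib by (intro sum.cong refl) (simp add: scaleR_conv_of_real[where 'a = complex])
    also have "(\<Sum>i\<in>UNIV. n x $ i * cnj (n x $ i)) = 1"
    proof -
      have "n x \<bullet> J (n x) = 0" using J_inner[of "n x" "n x"] by (simp add: inner_commute)
      then show ?thesis using norm_gradient[OF x] by (simp add: sum_mult_cnj norm_eq_1 complex_eq_iff)
    qed
    finally show ?thesis by simp
  qed
  then have "herm_norm (cgrad \<delta> x) = sqrt (1 / 8)" by (simp only: herm_norm_def Re_complex_of_real)
  moreover have "inverse (sqrt (1 / 8)) * (1 / 2) = sqrt 2"
  proof -
    have "sqrt (8::real) = 2 * sqrt 2" using real_sqrt_mult[of 4 2] by simp
    then show ?thesis by (simp add: real_sqrt_divide)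
  qed
  ultimately have "inverse (herm_norm (cgrad \<delta> x)) * (1 / 2) = sqrt 2" by simp
  then show ?thesis
    unfolding normalized_cgrad_def by (subst (2) c) (simp add: scaleR_prod_def)
qed

lemma nabla_normalized_cgrad:
  assumes x: "x \<in> W" and L: "type10 (L x)"
  shows "nabla L (normalized_cgrad \<delta>) x =
    ((sqrt 2 / 2) *\<^sub>R (H x (fst (L x)) - J (H x (J (fst (L x))))), 0)"
proof -
  have 1: "((\<lambda>q. fst (normalized_cgrad \<delta> q) $ i) has_derivative (\<lambda>h. (sqrt 2 *\<^sub>R H x h) $ i)) (at x)" for i
  proof (rule has_derivative_transform_within_open[OF _ open_W x])
    show "((\<lambda>q. (sqrt 2 *\<^sub>R n q) $ i) has_derivative (\<lambda>h. (sqrt 2 *\<^sub>R H x h) $ i)) (at x)"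
      by (rule has_derivative_nth[OF has_derivative_scaleR_right[OF has_derivative_n[OF x]]])
  qed (simp add: normalized_cgrad)
  have 2: "((\<lambda>q. snd (normalized_cgrad \<delta> q) $ i) has_derivative (\<lambda>h. 0)) (at x)" for i
    by (rule has_derivative_transform_within_open[OF has_derivative_const[of 0] open_W x])
       (simp add: normalized_cgrad)
  show ?thesis
    unfolding nabla_def deriv_along_type10[OF 1 L] deriv_along_type10[OF 2 L]
    by (simp add: vec_eq_iff scaleR_conv_of_real[where 'a = complex] algebra_simps diff_divide_distrib)
qed

text \<open>
  The imaginary part cancels because \<open>H\<close> is symmetric.
\<close>
lemma sum_H_cnj:
  assumes x: "x \<in> W"
  shows "(\<Sum>i\<in>UNIV. (H x u - J (H x (J u))) $ i * cnj (u $ i)) = of_real (Q x u)"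
proof -
  have "H x u \<bullet> J u = H x (J u) \<bullet> u" by (rule H_symmetric[OF x])
  then show ?thesis
    unfolding sum_mult_cnj Q_def
    by (simp add: inner_diff_left J_inner complex_eq_iff)
qed

lemma herm_nabla_normalized_cgrad:
  assumes x: "x \<in> W" and L: "type10 (L x)"
  shows "herm (nabla L (normalized_cgrad \<delta>) x) (L x) = of_real (sqrt 2 / 4 * Q x (fst (L x)))"
proof -
  have "herm (nabla L (normalized_cgrad \<delta>) x) (L x) =
    of_real (sqrt 2 / 4) * (\<Sum>i\<in>UNIV. (H x (fst (L x)) - J (H x (J (fst (L x))))) $ i * cnj (fst (L x) $ i))"
    unfolding herm_def nabla_normalized_cgrad[where L = L, OF assms] sum_divide_distrib sum_distrib_left
    by (intro sum.cong refl) (simp add: scaleR_conv_of_real[where 'a = complex])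
  then show ?thesis by (simp only: sum_H_cnj[OF x] of_real_mult)
qed

lemma complex_hess_eq:
  assumes x: "x \<in> W" and v: "type10 v"
  shows "complex_hess \<delta> x v = of_real (Q x (fst v) / 4)"
proof -
  have d: "((\<lambda>y. dzbar j (\<lambda>q. of_real (\<delta> q)) y) has_derivative (\<lambda>h. H x h $ j / 2)) (at x)" for j
  proof (rule has_derivative_transform_within_open[OF _ open_W x])
    show "((\<lambda>y. n y $ j / 2) has_derivative (\<lambda>h. H x h $ j / 2)) (at x)"
      by (rule bounded_linear.has_derivative[OF bounded_linear_divide has_derivative_nth[OF has_derivative_n[OF x]]])
  qed (simp add: dzbar_real differentiable)
  have "complex_hess \<delta> x v =
     (\<Sum>j\<in>UNIV. deriv_along v (dzbar j (\<lambda>q. of_real (\<delta> q))) x * cnj (fst v $ j))"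
    unfolding complex_hess_def deriv_along_def
    using v by (subst sum.swap) (simp add: type10_def sum_distrib_left sum_distrib_right mult_ac)
  also have "\<dots> = (\<Sum>j\<in>UNIV. (H x (fst v) - J (H x (J (fst v)))) $ j * cnj (fst v $ j)) / 4"
    unfolding deriv_along_type10[OF d v] sum_divide_distrib
    by (intro sum.cong refl) (simp add: field_simps)
  finally show ?thesis by (simp add: sum_H_cnj[OF x] del: vector_minus_component)
qed

lemma has_derivative_Q:
  assumes x: "x \<in> W" and u: "(u has_derivative u') (at x)"
  obtains D where "((\<lambda>y. Q y (u y)) has_derivative D) (at x)"
    "D (n x) = 2 * (H x (u x) \<bullet> u' (n x) + H x (J (u x)) \<bullet> J (u' (n x)))
       - (norm (H x (u x)))\<^sup>2 - (norm (H x (J (u x))))\<^sup>2"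
proof -
  obtain D1 where D1: "((\<lambda>y. H y (u y) \<bullet> u y) has_derivative D1) (at x)"
    "D1 (n x) = 2 * (H x (u x) \<bullet> u' (n x)) - (norm (H x (u x)))\<^sup>2"
    using has_derivative_H_quadratic[OF assms] by blast
  obtain D2 where D2: "((\<lambda>y. H y (J (u y)) \<bullet> J (u y)) has_derivative D2) (at x)"
    "D2 (n x) = 2 * (H x (J (u x)) \<bullet> J (u' (n x))) - (norm (H x (J (u x))))\<^sup>2"
    using has_derivative_H_quadratic[OF x bounded_linear.has_derivative[OF bounded_linear_J u]] by blast
  show thesis
  proof
    show "((\<lambda>y. Q y (u y)) has_derivative (\<lambda>h. D1 h + D2 h)) (at x)"
      unfolding Q_def by (rule has_derivative_add[OF D1(1) D2(1)])
  qed (simp add: D1(2) D2(2))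
qed

text \<open>
  Along the line \<open>u + t v\<close> the quadratic form is \<open>2 t b + t\<^sup>2 c\<close> with \<open>b\<close> the polar form; it can stay
  nonnegative for \<open>t\<close> of both signs only if \<open>b = 0\<close>.
\<close>
lemma null_vector_polar_zero:
  assumes x: "x \<in> W" and psd: "\<And>t. 0 \<le> Q x (u + t *\<^sub>R v)" and null: "Q x u = 0"
  shows "H x u \<bullet> v + H x (J u) \<bullet> J v = 0"
proof -
  define b where "b = H x u \<bullet> v + H x (J u) \<bullet> J v"
  note lin = linear_H[OF x]
  have expand: "Q x (u + t *\<^sub>R v) = 2 * t * b + t\<^sup>2 * Q x v" for t
  proof -
    have "Q x (u + t *\<^sub>R v) = Q x u + t * b + t * (H x v \<bullet> u + H x (J v) \<bullet> J u) + t\<^sup>2 * Q x v"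
      unfolding Q_def b_def linear_add[OF linear_J] linear_scale[OF linear_J] linear_add[OF lin] linear_scale[OF lin]
      by (simp add: inner_add_left inner_add_right algebra_simps power2_eq_square)
    then show ?thesis using H_symmetric[OF x, of v u] H_symmetric[OF x, of "J v" "J u"] null
      by (simp add: b_def)
  qed
  define c where "c = Q x v"
  have q: "0 \<le> 2 * t * b + t\<^sup>2 * c" for t using psd[of t] expand[of t] by (simp add: c_def)
  have "c \<ge> 0" using q[of 1] q[of "-1"] by simp
  \<comment> \<open>At \<open>t = - d\<close> the value is \<open>- d\<^sup>2 (c + 2)\<close>.\<close>
  define d where "d = b / (c + 1)"
  have bd: "b = d * (c + 1)" using \<open>c \<ge> 0\<close> by (simp add: d_def)
  have "d\<^sup>2 * (c + 2) \<le> 0" using q[of "- d"] by (simp add: bd algebra_simps power2_eq_square)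
  then have "d = 0" using \<open>c \<ge> 0\<close> by (simp add: mult_le_0_iff)
  then show ?thesis using bd by (simp add: b_def)
qed

end

section \<open>Null directions of the Levi form\<close>
context complex_unit_gradient
begin

text \<open>
  In the derivative of the quadratic form along the normal, the terms coming from the derivative of the
  field \<open>u\<close> form the polar form at \<open>u\<close> and \<open>u' n\<close>. Both vectors are complex tangential and \<open>u\<close> is a null
  vector, so these terms vanish, and the Riccati equation makes the rest nonpositive.
\<close>
lemma tangential_null_field_normal_derivative_nonpos:
  assumes p: "p \<in> W" and U: "open U" "p \<in> U" "smooth_on U L"
    and L: "\<And>q. q \<in> U \<Longrightarrow> type10 (L q)"
      "\<And>q. q \<in> U \<Longrightarrow> deriv_along (L q) (\<lambda>y. of_real (\<delta> y)) q = 0"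
    and psd: "\<And>v. n p \<bullet> v = 0 \<Longrightarrow> n p \<bullet> J v = 0 \<Longrightarrow> 0 \<le> Q p v"
    and null: "Q p (fst (L p)) = 0"
  shows "deriv_along (normalized_cgrad \<delta> p + conj_tangent (normalized_cgrad \<delta> p))
    (\<lambda>q. herm (nabla L (normalized_cgrad \<delta>) q) (L q)) p \<le> 0"
proof -
  define u where "u q = fst (L q)" for q
  have "Ck_on (Suc 0) U L" using U(3) unfolding smooth_on_def by blast
  then have "Ck_on (Suc 0) U u"
    unfolding u_def by (rule Ck_on_bounded_linear[OF U(1) bounded_linear_fst])
  from Ck_on_SucD(1)[OF this U(2)] obtain u' where u': "(u has_derivative u') (at p)" by blast
  have WU: "open (W \<inter> U)" "p \<in> W \<inter> U" using open_W U p by auto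
  have tang: "n q \<bullet> u q = 0 \<and> n q \<bullet> J (u q) = 0" if "q \<in> W \<inter> U" for q
    using that L[of q] deriv_along_real_zero_iff[OF differentiable, of q "L q"] by (simp add: u_def)
  have tang': "n p \<bullet> w' (n p) = 0"
    if w: "(w has_derivative w') (at p)" and 0: "\<And>q. q \<in> W \<inter> U \<Longrightarrow> n q \<bullet> w q = 0" for w w'
  proof -
    have 1: "((\<lambda>q. n q \<bullet> w q) has_derivative (\<lambda>h. n p \<bullet> w' h + H p h \<bullet> w p)) (at p)"
      by (rule has_derivative_inner[OF has_derivative_n[OF p] w])
    have 2: "((\<lambda>q. n q \<bullet> w q) has_derivative (\<lambda>h. 0)) (at p)"
      by (rule has_derivative_transform_within_open[OF has_derivative_const[of 0] WU]) (simp add: 0)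
    from fun_cong[OF has_derivative_unique[OF 1 2], of "n p"] show ?thesis by (simp add: H_n[OF p])
  qed
  have Tu': "n p \<bullet> u' (n p) = 0" by (rule tang'[OF u']) (use tang in blast)
  have TJu': "n p \<bullet> J (u' (n p)) = 0"
    by (rule tang'[OF bounded_linear.has_derivative[OF bounded_linear_J u']]) (use tang in blast)
  have polar: "H p (u p) \<bullet> u' (n p) + H p (J (u p)) \<bullet> J (u' (n p)) = 0"
  proof (rule null_vector_polar_zero[OF p])
    show "0 \<le> Q p (u p + t *\<^sub>R u' (n p))" for t
      by (rule psd) (use tang[OF WU(2)] Tu' TJu' in
        \<open>simp_all add: inner_add_right linear_add[OF linear_J] linear_scale[OF linear_J]\<close>)
    show "Q p (u p) = 0" using null by (simp add: u_def)
  qed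
  obtain D where D: "((\<lambda>q. Q q (u q)) has_derivative D) (at p)"
    "D (n p) = 2 * (H p (u p) \<bullet> u' (n p) + H p (J (u p)) \<bullet> J (u' (n p)))
       - (norm (H p (u p)))\<^sup>2 - (norm (H p (J (u p))))\<^sup>2"
    using has_derivative_Q[OF p u'] by blast
  have "D (n p) \<le> 0" using D(2) polar by (simp add: add_nonneg_nonneg)
  have herm: "((\<lambda>q. herm (nabla L (normalized_cgrad \<delta>) q) (L q)) has_derivative
      (\<lambda>h. of_real (sqrt 2 / 4 * D h))) (at p)"
  proof (rule has_derivative_transform_within_open[OF has_derivative_of_real[OF
        has_derivative_mult_right[OF D(1)]] WU])
    show "of_real (sqrt 2 / 4 * Q q (u q)) = herm (nabla L (normalized_cgrad \<delta>) q) (L q)"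
      if "q \<in> W \<inter> U" for q
      using herm_nabla_normalized_cgrad[where L = L, of q] that L(1) by (simp add: u_def)
  qed
  have N: "type10 (normalized_cgrad \<delta> p)" "fst (normalized_cgrad \<delta> p) = sqrt 2 *\<^sub>R n p"
    using normalized_cgrad[OF p] by (simp_all add: type10_def)
  have "D (sqrt 2 *\<^sub>R n p) = sqrt 2 * D (n p)"
    using linear_scale[OF has_derivative_linear[OF D(1)]] by simp
  then show ?thesis
    unfolding deriv_along_add_conj[OF herm N(1)] N(2)
    using \<open>D (n p) \<le> 0\<close> by (simp add: less_eq_complex_def mult_le_0_iff)
qed

text \<open>
  By the Riccati equation the quadratic form at \<open>v\<close> is nondecreasing along the inward normal. Being
  nonnegative at the start and zero at the end, it is constant, and its derivative
  \<open>(norm (H v))\<^sup>2 + (norm (H (J v)))\<^sup>2\<close> vanishes.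
\<close>
lemma null_direction_along_normal_segment:
  assumes s: "0 < s" and W: "\<And>\<tau>. \<tau> \<in> {0..s} \<Longrightarrow> p - \<tau> *\<^sub>R n p \<in> W"
    and n: "\<And>\<tau>. \<tau> \<in> {0..s} \<Longrightarrow> n (p - \<tau> *\<^sub>R n p) = n p"
    and pos: "0 \<le> Q p v" and null: "Q (p - s *\<^sub>R n p) v = 0"
  shows "H (p - s *\<^sub>R n p) v = 0" "H (p - s *\<^sub>R n p) (J v) = 0"
proof -
  define \<phi> where "\<phi> \<tau> = Q (p + \<tau> *\<^sub>R (- n p)) v" for \<tau>
  have \<phi>': "(\<phi> has_real_derivative (norm (H (p - \<tau> *\<^sub>R n p) v))\<^sup>2 + (norm (H (p - \<tau> *\<^sub>R n p) (J v)))\<^sup>2) (at \<tau> within X)"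
    if t: "\<tau> \<in> {0..s}" for \<tau> X
  proof -
    let ?y = "p - \<tau> *\<^sub>R n p"
    obtain D where D: "((\<lambda>y. Q y v) has_derivative D) (at ?y)"
      "D (n ?y) = - (norm (H ?y v))\<^sup>2 - (norm (H ?y (J v)))\<^sup>2"
      using has_derivative_Q[OF W[OF t] has_derivative_const[of v]]
      by (auto simp: linear_0[OF linear_J])
    have "D (- n p) = (norm (H ?y v))\<^sup>2 + (norm (H ?y (J v)))\<^sup>2"
      using D(2) linear_neg[OF has_derivative_linear[OF D(1)], of "n p"] n[OF t] by simp
    then show ?thesis
      using has_real_derivative_along_line[of "\<lambda>y. Q y v" D p \<tau> "- n p" X] D(1)
      by (simp add: \<phi>_def[abs_def])
  qed
  have mono: "\<phi> a \<le> \<phi> b" if "0 \<le> a" "a \<le> b" "b \<le> s" for a b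
  proof (rule DERIV_nonneg_imp_nondecreasing[OF that(2)])
    fix \<tau> assume "a \<le> \<tau>" "\<tau> \<le> b"
    then have "\<tau> \<in> {0..s}" using that by simp
    from \<phi>'[OF this, of UNIV] show "\<exists>y. (\<phi> has_real_derivative y) (at \<tau>) \<and> 0 \<le> y"
      by (meson add_nonneg_nonneg zero_le_power2)
  qed
  have const: "\<phi> \<tau> = 0" if "\<tau> \<in> {0..s}" for \<tau>
    using mono[of 0 \<tau>] mono[of \<tau> s] that pos null by (simp add: \<phi>_def)
  have "s \<in> {0..s}" using s by simp
  from \<phi>'[OF this, of "{0..s}"]
  have 1: "((\<lambda>\<tau>. 0) has_vector_derivative (norm (H (p - s *\<^sub>R n p) v))\<^sup>2 + (norm (H (p - s *\<^sub>R n p) (J v)))\<^sup>2) (at s within {0..s})"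
    unfolding has_real_derivative_iff_has_vector_derivative
    by (rule has_vector_derivative_transform[OF \<open>s \<in> {0..s}\<close>, rotated]) (use const in simp)
  have "(norm (H (p - s *\<^sub>R n p) v))\<^sup>2 + (norm (H (p - s *\<^sub>R n p) (J v)))\<^sup>2 = 0"
    using vector_derivative_unique_within[OF _ 1 has_vector_derivative_const] s
    by (simp add: trivial_limit_within islimpt_Icc)
  then show "H (p - s *\<^sub>R n p) v = 0" "H (p - s *\<^sub>R n p) (J v) = 0"
    by (simp_all add: sum_power2_eq_zero_iff)
qed

text \<open>
  For each positive parameter the preceding lemma is applied to the constant value of the field at that
  point: the complex tangent spaces agree along the segment, so the value is also tangential at \<open>p\<close>. The
  boundary point itself is reached by continuity.
\<close>
lemma nabla_normalized_cgrad_null_along_normal_segment: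
  assumes \<epsilon>: "0 < \<epsilon>" and seg: "\<And>\<tau>. \<tau> \<in> {0..\<epsilon>} \<Longrightarrow> p - \<tau> *\<^sub>R n p \<in> W \<inter> U"
    and n: "\<And>\<tau>. \<tau> \<in> {0..\<epsilon>} \<Longrightarrow> n (p - \<tau> *\<^sub>R n p) = n p"
    and U: "open U" "smooth_on U L"
    and L: "\<And>q. q \<in> U \<Longrightarrow> type10 (L q)"
      "\<And>q. q \<in> U \<Longrightarrow> deriv_along (L q) (\<lambda>y. of_real (\<delta> y)) q = 0"
    and psd: "\<And>v. n p \<bullet> v = 0 \<Longrightarrow> n p \<bullet> J v = 0 \<Longrightarrow> 0 \<le> Q p v"
    and null: "\<And>\<tau>. \<tau> \<in> {0<..\<epsilon>} \<Longrightarrow> Q (p - \<tau> *\<^sub>R n p) (fst (L (p - \<tau> *\<^sub>R n p))) = 0"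
    and \<tau>: "\<tau> \<in> {0..\<epsilon>}"
  shows "nabla L (normalized_cgrad \<delta>) (p - \<tau> *\<^sub>R n p) = 0"
proof -
  define u where "u q = fst (L q)" for q
  have "Ck_on (Suc 0) U L" using U(2) unfolding smooth_on_def by blast
  then have uk: "Ck_on (Suc 0) U u"
    unfolding u_def by (rule Ck_on_bounded_linear[OF U(1) bounded_linear_fst])
  define y where "y \<tau> = p - \<tau> *\<^sub>R n p" for \<tau>
  have cont: "continuous_on {0..\<epsilon>} (\<lambda>\<tau>. H (y \<tau>) (w (y \<tau>)))" if w: "Ck_on (Suc 0) U w" for w
  proof -
    have "isCont (\<lambda>q. H q (w q)) q" if "q \<in> W \<inter> U" for q
      using has_derivative_continuous[OF has_derivative_H_field[OF _ Ck_on_SucD(1)[OF w]]] that by simp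
    then have "continuous_on (W \<inter> U) (\<lambda>q. H q (w q))" by (simp add: continuous_at_imp_continuous_on)
    then show ?thesis
      by (rule continuous_on_compose2) (use seg in \<open>auto simp: y_def intro!: continuous_intros\<close>)
  qed
  have pos: "H (y \<tau>) (u (y \<tau>)) = 0 \<and> H (y \<tau>) (J (u (y \<tau>))) = 0" if t: "\<tau> \<in> {0<..\<epsilon>}" for \<tau>
  proof -
    have t': "\<tau> \<in> {0..\<epsilon>}" using t by simp
    have "n p \<bullet> u (y \<tau>) = 0 \<and> n p \<bullet> J (u (y \<tau>)) = 0"
      using seg[OF t'] L[of "y \<tau>"] n[OF t'] deriv_along_real_zero_iff[OF differentiable, of "y \<tau>" "L (y \<tau>)"]
      by (simp add: u_def y_def)
    then have "0 \<le> Q p (u (y \<tau>))" using psd by blast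
    with null_direction_along_normal_segment[of \<tau> p "u (y \<tau>)"] seg n null[OF t] t
    show ?thesis by (auto simp: y_def u_def)
  qed
  have closure: "closure {0<..\<epsilon>} = {0..\<epsilon>}" using \<epsilon> by (rule closure_greaterThanAtMost)
  have "H (y \<tau>) (u (y \<tau>)) = 0"
    by (rule continuous_constant_on_closure[of "{0<..\<epsilon>}"]) (use cont[OF uk] pos \<tau> closure in auto)
  moreover have "H (y \<tau>) (J (u (y \<tau>))) = 0"
    by (rule continuous_constant_on_closure[of "{0<..\<epsilon>}"])
       (use cont[OF Ck_on_bounded_linear[OF U(1) bounded_linear_J uk]] pos \<tau> closure in auto)
  ultimately show ?thesis
    using nabla_normalized_cgrad[where L = L, of "y \<tau>"] seg[OF \<tau>] L(1)
    by (simp add: y_def u_def linear_0[OF linear_J] zero_prod_def)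
qed

end

section \<open>Inner domains and the main result\<close>
lemma inner_domain_0: "inner_domain \<Omega> 0 = \<Omega>"
  by (auto simp: inner_domain_def signed_distance_def infdist_nonneg)

text \<open>
  Points of the inner domain with larger distance are interior points, and boundary points of \<open>\<Omega>\<close> have
  distance zero, so neither kind belongs to the frontier.
\<close>
lemma frontier_inner_domain:
  assumes "open \<Omega>" "0 < s" "x \<in> frontier (inner_domain \<Omega> s)"
  shows "x \<in> \<Omega>" "infdist x (frontier \<Omega>) = s"
proof -
  let ?d = "\<lambda>x. infdist x (frontier \<Omega>)"
  have eq: "inner_domain \<Omega> s = \<Omega> \<inter> {x. s \<le> ?d x}"
    by (auto simp: inner_domain_def signed_distance_def)
  have "closed {x. s \<le> ?d x}" by (intro closed_Collect_le continuous_intros)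
  then have "closure (inner_domain \<Omega> s) \<subseteq> closure \<Omega> \<inter> {x. s \<le> ?d x}"
    unfolding eq by (metis Int_greatest Int_lower1 Int_lower2 closure_minimal closure_mono)
  then have x: "x \<in> closure \<Omega>" "s \<le> ?d x" using assms(3) by (auto simp: frontier_def)
  show "x \<in> \<Omega>"
  proof (rule ccontr)
    assume "x \<notin> \<Omega>"
    then have "x \<in> frontier \<Omega>" using x(1) assms(1) by (simp add: frontier_def interior_open)
    then show False using x(2) assms(2) by simp
  qed
  show "?d x = s"
  proof (rule ccontr)
    assume "?d x \<noteq> s"
    then have "x \<in> \<Omega> \<inter> {x. s < ?d x}" using x(2) \<open>x \<in> \<Omega>\<close> by simp
    moreover have "open (\<Omega> \<inter> {x. s < ?d x})"
      by (intro open_Int assms(1) open_Collect_less continuous_intros)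
    moreover have "\<Omega> \<inter> {x. s < ?d x} \<subseteq> inner_domain \<Omega> s" unfolding eq by auto
    ultimately have "x \<in> interior (inner_domain \<Omega> s)" by (meson interiorI)
    then show False using assms(3) by (simp add: frontier_def)
  qed
qed

theorem corollary3p1:
  fixes \<Omega> :: "(complex ^ 'n::finite) set"
    and \<delta> :: "complex ^ 'n \<Rightarrow> real"
    and N :: "complex ^ 'n \<Rightarrow> 'n ctangent"
  assumes "open \<Omega>" "connected \<Omega>" "\<Omega> \<noteq> {}" "bounded \<Omega>"
    and "smooth_boundary \<Omega>"
    and "pseudoconvex \<Omega>"
    and "\<delta> = signed_distance \<Omega>"
    and "N = normalized_cgrad \<delta>"
  shows "(\<forall>p\<in>frontier \<Omega>. \<forall>U L.
            tangential_field \<Omega> U L \<and> p \<in> U \<and> complex_hess \<delta> p (L p) = 0 \<longrightarrow>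
            deriv_along (N p + conj_tangent (N p)) (\<lambda>q. herm (nabla L N q) (L q)) p \<le> 0)
       \<and> (\<forall>\<^sub>F \<epsilon> in at_right 0. \<forall>p\<in>frontier \<Omega>. \<forall>x U L.
            (\<forall>s\<in>{0<..\<epsilon>}. x s \<in> frontier (inner_domain \<Omega> s) \<and>
                          dist (x s) p = infdist (x s) (frontier \<Omega>)) \<and>
            tangential_field \<Omega> U L \<and> closed_segment (x \<epsilon>) p \<subseteq> U \<and>
            (\<forall>s\<in>{0<..\<epsilon>}. complex_hess \<delta> (x s) (L (x s)) = 0) \<longrightarrow>
            (\<forall>\<epsilon>'\<in>{0..\<epsilon>}. \<exists>p'.
               closed_segment (x \<epsilon>) p \<inter> frontier (inner_domain \<Omega> \<epsilon>') = {p'} \<and>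
               herm (nabla L N p') (N p') = 0))"
proof -
  obtain W where W: "open W" "frontier \<Omega> \<subseteq> W" "smooth_on W (gradient \<delta>)"
    "\<And>x. x \<in> W \<Longrightarrow> \<delta> differentiable (at x)" "\<And>x. x \<in> W \<Longrightarrow> norm (gradient \<delta> x) = 1"
    using signed_distance_tubular_neighborhood[OF assms(1,5)] assms(7) by metis
  interpret complex_unit_gradient \<delta> W
    by unfold_locales (use W in auto)
  have psd: "0 \<le> Q p v" if p: "p \<in> frontier \<Omega>" and v: "n p \<bullet> v = 0" "n p \<bullet> J v = 0" for p v
  proof -
    have "p \<in> W" using p W(2) by blast
    have v10: "type10 (v, 0 :: complex ^ 'n)" by (simp add: type10_def)
    then have "(v, 0) \<in> tangent10 \<Omega> p"
      using deriv_along_real_zero_iff[OF W(4)[OF \<open>p \<in> W\<close>] v10] v assms(7) by (simp add: tangent10_def)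
    then have "0 \<le> complex_hess \<delta> p (v, 0)"
      using assms(6,7) p unfolding pseudoconvex_def by blast
    then show ?thesis
      unfolding complex_hess_eq[OF \<open>p \<in> W\<close> v10] by (simp add: less_eq_complex_def)
  qed
  have field: "open U" "smooth_on U L" "\<And>q. q \<in> U \<Longrightarrow> type10 (L q)"
    "\<And>q. q \<in> U \<Longrightarrow> deriv_along (L q) (\<lambda>y. of_real (\<delta> y)) q = 0"
    if "tangential_field \<Omega> U L" for U L
    using that by (auto simp: tangential_field_def assms(7))
  have null: "Q q (fst (L q)) = 0" if "complex_hess \<delta> q (L q) = 0" "q \<in> W" "type10 (L q)"
    for q and L :: "complex ^ 'n \<Rightarrow> 'n ctangent"
    using that complex_hess_eq[of q "L q"] by simp
  show ?thesis
  proof (intro conjI ballI allI impI; (elim conjE)?)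
    fix p U L assume p: "p \<in> frontier \<Omega>" and L: "tangential_field \<Omega> U L" "p \<in> U"
      and 0: "complex_hess \<delta> p (L p) = 0"
    have "p \<in> W" using p W(2) by blast
    show "deriv_along (N p + conj_tangent (N p)) (\<lambda>q. herm (nabla L N q) (L q)) p \<le> 0"
      unfolding assms(8)
      by (rule tangential_null_field_normal_derivative_nonpos[OF \<open>p \<in> W\<close> field(1)[OF L(1)] L(2)
          field(2-4)[OF L(1)] psd[OF p] null[of p L, OF 0 \<open>p \<in> W\<close> field(3)[OF L]]])
  next
    \<comment> \<open>Compactness of the boundary makes the width of the tubular neighborhood uniform in \<open>p\<close>.\<close>
    have "compact (frontier \<Omega>)" using assms(4) by (simp add: compact_frontier_bounded)
    from compact_subset_open_imp_ball_epsilon_subset[OF this W(1,2)]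
    obtain \<epsilon>0 where \<epsilon>0: "\<epsilon>0 > 0" "(\<Union>p\<in>frontier \<Omega>. ball p \<epsilon>0) \<subseteq> W" by blast
    have main: "\<exists>p'. closed_segment (x \<epsilon>) p \<inter> frontier (inner_domain \<Omega> \<epsilon>') = {p'} \<and>
               herm (nabla L N p') (N p') = 0"
      if \<epsilon>: "0 < \<epsilon>" "\<epsilon> < \<epsilon>0" and p: "p \<in> frontier \<Omega>"
        and x: "\<forall>s\<in>{0<..\<epsilon>}. x s \<in> frontier (inner_domain \<Omega> s) \<and> dist (x s) p = infdist (x s) (frontier \<Omega>)"
        and L: "tangential_field \<Omega> U L" and sub: "closed_segment (x \<epsilon>) p \<subseteq> U"
        and hess: "\<forall>s\<in>{0<..\<epsilon>}. complex_hess \<delta> (x s) (L (x s)) = 0" and \<epsilon>': "\<epsilon>' \<in> {0..\<epsilon>}"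
      for \<epsilon> p x U L \<epsilon>'
    proof -
      have xs: "x s \<in> \<Omega>" "infdist (x s) (frontier \<Omega>) = s" "dist (x s) p = s" if "s \<in> {0<..\<epsilon>}" for s
        using frontier_inner_domain[OF assms(1), of s "x s"] x that by auto
      have segW: "closed_segment (x s) p \<subseteq> W" if "s \<in> {0<..\<epsilon>}" for s
      proof -
        have "x s \<in> ball p \<epsilon>0" "p \<in> ball p \<epsilon>0" using xs(3)[OF that] that \<epsilon> \<epsilon>0(1) by (auto simp: dist_commute)
        then have "closed_segment (x s) p \<subseteq> ball p \<epsilon>0" by (intro closed_segment_subset convex_ball)
        then show ?thesis using \<epsilon>0(2) p by blast
      qed
      have near: "x s = p - s *\<^sub>R n p" "\<And>\<tau>. \<tau> \<in> {0..s} \<Longrightarrow> n (p - \<tau> *\<^sub>R n p) = n p"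
        "\<And>\<tau>. \<tau> \<in> {0..s} \<Longrightarrow> infdist (p - \<tau> *\<^sub>R n p) (frontier \<Omega>) = \<tau>" if s: "s \<in> {0<..\<epsilon>}" for s
        using segment_to_nearest_boundary_point[OF p xs(1)[OF s] xs(3)[OF s] xs(2)[OF s]] s W(4,5) segW[OF s]
        unfolding assms(7) by (auto simp: subset_iff)
      have \<epsilon>\<epsilon>: "\<epsilon> \<in> {0<..\<epsilon>}" using \<epsilon> by simp
      note near\<epsilon> = near[OF \<epsilon>\<epsilon>]
      have segment: "closed_segment (x \<epsilon>) p = (\<lambda>\<tau>. p - \<tau> *\<^sub>R n p) ` {0..\<epsilon>}"
      proof -
        have "closed_segment p (p - \<epsilon> *\<^sub>R n p) = (\<lambda>u. p - (\<epsilon> * u) *\<^sub>R n p) ` {0..1}"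
          unfolding closed_segment_image_interval by (intro image_cong refl) (simp add: algebra_simps)
        also have "\<dots> = (\<lambda>\<tau>. p - \<tau> *\<^sub>R n p) ` ((*) \<epsilon> ` {0..1})" by (simp add: image_image)
        also have "(*) \<epsilon> ` {0..1} = {0..\<epsilon>}" using \<epsilon>(1) by (simp add: image_mult_atLeastAtMost)
        finally show ?thesis using near\<epsilon>(1) by (simp add: closed_segment_commute)
      qed
      have on_seg: "p - \<tau> *\<^sub>R n p \<in> closed_segment (x \<epsilon>) p" if "\<tau> \<in> {0..\<epsilon>}" for \<tau>
        using that segment by blast
      define p' where "p' = p - \<epsilon>' *\<^sub>R n p"
      have "p' \<in> frontier (inner_domain \<Omega> \<epsilon>')"
      proof (cases "\<epsilon>' = 0")
        case True
        then show ?thesis using p by (simp add: p'_def inner_domain_0)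
      next
        case False
        then have "\<epsilon>' \<in> {0<..\<epsilon>}" using \<epsilon>' by simp
        then show ?thesis using x near(1) by (simp add: p'_def)
      qed
      moreover have "\<tau> = \<epsilon>'" if "\<tau> \<in> {0..\<epsilon>}" "p - \<tau> *\<^sub>R n p \<in> frontier (inner_domain \<Omega> \<epsilon>')" for \<tau>
      proof (cases "\<epsilon>' = 0")
        case True
        then show ?thesis using that near\<epsilon>(3)[OF that(1)] by (simp add: inner_domain_0)
      next
        case False
        then have "0 < \<epsilon>'" using \<epsilon>' by simp
        from frontier_inner_domain(2)[OF assms(1) this that(2)] near\<epsilon>(3)[OF that(1)]
        show ?thesis by simp
      qed
      ultimately have "closed_segment (x \<epsilon>) p \<inter> frontier (inner_domain \<Omega> \<epsilon>') = {p'}"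
        using on_seg[OF \<epsilon>'] segment by (auto simp: p'_def)
      moreover have "nabla L N p' = 0"
        unfolding assms(8) p'_def
      proof (rule nabla_normalized_cgrad_null_along_normal_segment[OF \<epsilon>(1) _ near\<epsilon>(2)
            field(1,2)[OF L] field(3,4)[OF L] psd[OF p] _ \<epsilon>'])
        show "p - \<tau> *\<^sub>R n p \<in> W \<inter> U" if "\<tau> \<in> {0..\<epsilon>}" for \<tau>
          using on_seg[OF that] sub segW[OF \<epsilon>\<epsilon>] by blast
      next
        fix \<tau> assume t: "\<tau> \<in> {0<..\<epsilon>}"
        have "p - \<tau> *\<^sub>R n p \<in> W" "p - \<tau> *\<^sub>R n p \<in> U"
          using on_seg[of \<tau>] t sub segW[OF \<epsilon>\<epsilon>] by auto
        moreover have "complex_hess \<delta> (p - \<tau> *\<^sub>R n p) (L (p - \<tau> *\<^sub>R n p)) = 0"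
          using bspec[OF hess t] by (simp only: near(1)[OF t])
        ultimately show "Q (p - \<tau> *\<^sub>R n p) (fst (L (p - \<tau> *\<^sub>R n p))) = 0"
          using null field(3)[OF L] by blast
      qed
      then have "herm (nabla L N p') (N p') = 0" by (simp add: herm_def)
      ultimately show ?thesis by blast
    qed
    show "\<forall>\<^sub>F \<epsilon> in at_right 0. \<forall>p\<in>frontier \<Omega>. \<forall>x U L.
            (\<forall>s\<in>{0<..\<epsilon>}. x s \<in> frontier (inner_domain \<Omega> s) \<and>
                          dist (x s) p = infdist (x s) (frontier \<Omega>)) \<and>
            tangential_field \<Omega> U L \<and> closed_segment (x \<epsilon>) p \<subseteq> U \<and>
            (\<forall>s\<in>{0<..\<epsilon>}. complex_hess \<delta> (x s) (L (x s)) = 0) \<longrightarrow>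
            (\<forall>\<epsilon>'\<in>{0..\<epsilon>}. \<exists>p'.
               closed_segment (x \<epsilon>) p \<inter> frontier (inner_domain \<Omega> \<epsilon>') = {p'} \<and>
               herm (nabla L N p') (N p') = 0)"
      unfolding eventually_at_right_field
      by (intro exI[of _ \<epsilon>0] conjI \<epsilon>0(1) allI impI ballI; elim conjE; rule main; assumption?)
  qed
qed

end
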